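(* Let $\mathcal G=(V,E,\mathfrak c)$ be a countably infinite connected graph with conductances such that $\pi(x)=\sum_{y\sim x}\mathfrak c(x,y)<\infty$ for all $x\in V$, let $\mathcal A\subset V$ be non-empty and finite, and let $G_{\mathcal A}$ be the Green's function for random walk on $\mathcal G$ reflected off of infinity and killed upon hitting $\mathcal A$. For each $x,y\in V$, we have $G_{\mathcal A}(x,y)<\infty$. Furthermore, for each fixed $y\in V$, the function $x\mapsto G_{\mathcal A}(x,y)$ is discrete harmonic on $V\setminus(\mathcal A\cup\{y\})$, and if $y\notin\mathcal A$, then $$\sum_{x\sim y}\mathfrak c(y,x)\left(G_{\mathcal A}(x,y)-G_{\mathcal A}(y,y)\right)=-\pi(y).$$
   Context: $\mathcal G=(V,E,\mathfrak c)$ is a graph with vertex set $V$, set $E$ of unoriented edges (unordered pairs of distinct vertices) and conductance function $\mathfrak c:E\to(0,\infty)$. Write $x\sim y$ if $x$ and $y$ are joined by an edge, in which case $\mathfrak c(x,y)=\mathfrak c(y,x)$ is its conductance. Vertices may have infinite degree. A function $h:V\to\mathbb R$ is discrete harmonic at $x$ if $\sum_{y\sim x}\mathfrak c(x,y)|h(y)-h(x)|<\infty$ and $\sum_{y\sim x}\mathfrak c(x,y)(h(y)-h(x))=0$. Energy-minimizing functions. $\operatorname{Energy}(f)=\sum_{\{x,y\}\in E}\mathfrak c(x,y)|f(y)-f(x)|^2$. For each non-empty finite $\mathcal A\subset V$ and $\phi:\mathcal A\to\mathbb R$ there is a unique $h^\phi:V\to\mathbb R$ with $h^\phi|_{\mathcal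 A}=\phi$ of minimal energy among all functions $f:V\to\mathbb R$ with $f|_{\mathcal A}=\phi$. Random walk reflected off of infinity. There is a function $\mathfrak w_*:V\to(0,\infty)$ such that for every $\mathfrak w:V\to(0,\infty)$ with $\mathfrak w\ge\mathfrak w_*$ pointwise there is a unique (in law) family of processes $X:[0,\infty)\to V\cup\{\infty\}$, started from $X_0=z$ for each $z\in V$ (law $\mathbb P_z$), such that: (i) for each $t\ge0$, a.s. $X_t\in V$ and $X$ is constant on a neighbourhood of $t$ in $[0,\infty)$; (ii) a.s., for every $t\ge 0$ with $X_t\in V$ there is $\varepsilon>0$ with $X_s=X_t$ for all $s\in[t,t+\varepsilon]$; (iii) with $\tau=\min\{t>0:X_t\ne z\}$, $\tau$ and $X_\tau$ are independent, $\tau$ is exponential with rate $\mathfrak w(z)$, and $\mathbb P_z[X_\tau=x]=\mathfrak c(z,x)/\pi(z)$ for $x\sim z$; (iv) for $t\ge0$ and $x\in V$, on $\{X_t=x\}$ the conditional law of $\{X_{s+t}\}_{s\ge0}$ given $\{X_s\}_{s\le t}$ is the law of $X$ under $\mathbb P_x$; (v) a.s. there are arbitrarily large $t$ with $X_t=z$; (vi) for every non-empty finite $\mathcal A\subset V$, $\phi:\mathcal A\to\mathbb R$ and $z\in V$, with $\tau=\min\{t\ge0:X_t\in\mathcal A\}$, $h^\phi(z)=\mathbb E_z[\phi(X_\tau)]$. Fix such $\mathfrak w_*$ and $\mathfrak w\ge\mathfrak w_*$; $X$ denotes this process. Green's function. For a non-empty finite $\mathcal A\subset V$ let $\tau_{\mathcal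 A}=\min\{t\ge0:X_t\in\mathcal A\}$, and for $y\in V$ let $N_{\mathcal A}(y)$ be the number of distinct visits of $X$ to $y$ strictly before time $\tau_{\mathcal A}$, i.e. the number of connected components of $X^{-1}(y)\cap[0,\tau_{\mathcal A})$. Then $G_{\mathcal A}(x,y)=\mathbb E_x[N_{\mathcal A}(y)]$. *)

theory Defs
  imports "HOL-Probability.Probability"
begin

section \<open>Graphs with conductances\<close>

text \<open>
  The vertex set is the whole type \<open>'v\<close>, an edge is a two-element set of vertices, and
  \<open>c {x, y}\<close> is the conductance of the edge \<open>{x, y}\<close>.  Values of \<open>c\<close> outside \<open>E\<close> play no role.
\<close>

locale conductance_graph =
  fixes E :: "'v set set" and c :: "'v set \<Rightarrow> real"
  assumes edges: "e \<in> E \<Longrightarrow> \<exists>x y. x \<noteq> y \<and> e = {x, y}"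
    and conductance_pos: "e \<in> E \<Longrightarrow> 0 < c e"

definition neighbours :: "'v set set \<Rightarrow> 'v \<Rightarrow> 'v set"
  where "neighbours E x = {y. {x, y} \<in> E}"

definition connected_graph :: "'v set set \<Rightarrow> bool"
  where "connected_graph E \<longleftrightarrow> (\<forall>x y. (x, y) \<in> {(u, v). v \<in> neighbours E u}\<^sup>*)"

definition total_conductance :: "'v set set \<Rightarrow> ('v set \<Rightarrow> real) \<Rightarrow> 'v \<Rightarrow> real"
  where "total_conductance E c x = (\<Sum>\<^sub>\<infinity>y\<in>neighbours E x. c {x, y})"

definition discrete_harmonic_at ::
    "'v set set \<Rightarrow> ('v set \<Rightarrow> real) \<Rightarrow> ('v \<Rightarrow> real) \<Rightarrow> 'v \<Rightarrow> bool"
  where "discrete_harmonic_at E c h x \<longleftrightarrow>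
    (\<lambda>y. c {x, y} * \<bar>h y - h x\<bar>) summable_on neighbours E x \<and>
    (\<Sum>\<^sub>\<infinity>y\<in>neighbours E x. c {x, y} * (h y - h x)) = 0"

text \<open>For an edge \<open>e = {x, y}\<close>, \<open>Max (f ` e) - Min (f ` e)\<close> is \<open>\<bar>f y - f x\<bar>\<close>.\<close>

definition energy :: "'v set set \<Rightarrow> ('v set \<Rightarrow> real) \<Rightarrow> ('v \<Rightarrow> real) \<Rightarrow> ennreal"
  where "energy E c f = (\<Sum>\<^sub>\<infinity>e\<in>E. ennreal (c e * (Max (f ` e) - Min (f ` e))\<^sup>2))"

definition is_energy_minimizer ::
    "'v set set \<Rightarrow> ('v set \<Rightarrow> real) \<Rightarrow> 'v set \<Rightarrow> ('v \<Rightarrow> real) \<Rightarrow> ('v \<Rightarrow> real) \<Rightarrow> bool"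
  where "is_energy_minimizer E c A \<phi> h \<longleftrightarrow>
    (\<forall>a\<in>A. h a = \<phi> a) \<and>
    (\<forall>f. (\<forall>a\<in>A. f a = \<phi> a) \<longrightarrow> energy E c h \<le> energy E c f)"

definition energy_minimizer ::
    "'v set set \<Rightarrow> ('v set \<Rightarrow> real) \<Rightarrow> 'v set \<Rightarrow> ('v \<Rightarrow> real) \<Rightarrow> 'v \<Rightarrow> real"
  where "energy_minimizer E c A \<phi> = (THE h. is_energy_minimizer E c A \<phi> h)"


section \<open>Paths\<close>

text \<open>
  A path is a function \<open>p :: real \<Rightarrow> 'v option\<close> of which only the values at times \<open>t \<ge> 0\<close> matter;
  \<open>None\<close> is the point at infinity.  Minima of sets of times are written with \<open>LEAST\<close>, which is
  meaningful only if the minimum is attained.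
\<close>

definition has_minimum :: "real set \<Rightarrow> bool"
  where "has_minimum S \<longleftrightarrow> (\<exists>m\<in>S. \<forall>s\<in>S. m \<le> s)"

definition exit_time :: "'v \<Rightarrow> (real \<Rightarrow> 'v option) \<Rightarrow> real"
  where "exit_time z p = (LEAST t. 0 < t \<and> p t \<noteq> Some z)"

definition hitting_time :: "'v set \<Rightarrow> (real \<Rightarrow> 'v option) \<Rightarrow> real"
  where "hitting_time A p = (LEAST t. 0 \<le> t \<and> p t \<in> Some ` A)"

definition visits_before :: "'v set \<Rightarrow> 'v \<Rightarrow> (real \<Rightarrow> 'v option) \<Rightarrow> ennreal"
  where "visits_before A y p =
    emeasure (count_space UNIV) (components {t \<in> {0..<hitting_time A p}. p t = Some y})"

definition shift_path :: "real \<Rightarrow> (real \<Rightarrow> 'v option) \<Rightarrow> (real \<Rightarrow> 'v option)"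
  where "shift_path t p = (\<lambda>s. p (s + t))"

text \<open>
  The sigma-algebra on paths with respect to which laws are taken (and, for \<open>T = {0..t}\<close>, the one
  generated by the path up to time \<open>t\<close>).  It is generated by the events that the path sits at a
  given vertex throughout a given closed interval; the degenerate intervals \<open>{a..a}\<close> give the
  coordinate maps.  The coordinate maps alone would not do: they do not see
  whether a holding interval is interrupted at a random time by an instantaneous excursion to
  infinity, while the number of visits to a vertex depends on this, so that the Markov property
  for finite-dimensional distributions alone does not control the number of visits.
\<close>

definition path_algebra :: "real set \<Rightarrow> (real \<Rightarrow> 'v option) measure"
  where "path_algebra T =
    sigma UNIV {{p. \<forall>s\<in>{a..b}. p s = Some x} | a b x. a \<le> b \<and> {a..b} \<subseteq> T}"


section \<open>Random walk reflected off of infinity\<close>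

text \<open>
  \<open>X z \<omega>\<close> is the path of the process started at \<open>z\<close>, defined on the probability space \<open>P z\<close>.
  The probability spaces are complete, so that random times and positions that are determined only
  almost surely by countably many measurable events are measurable; replacing each \<open>P z\<close> by its
  completion changes no law.  Each condition that mentions a minimum of a random set of times
  includes that the minimum is almost surely attained.

  The jump rates \<open>w\<close> are arbitrary: for \<open>w\<close> above the threshold function that guarantees existence
  and uniqueness in law, the walk is the family characterised by these conditions.
\<close>

locale reflected_walk = conductance_graph E c
  for E :: "'v set set" and c :: "'v set \<Rightarrow> real" +
  fixes w :: "'v \<Rightarrow> real"
    and P :: "'v \<Rightarrow> 'w measure"
    and X :: "'v \<Rightarrow> 'w \<Rightarrow> real \<Rightarrow> 'v option"
  assumes rate_pos: "0 < w z"
    and prob_space: "prob_space (P z)"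
    and complete: "complete_measure (P z)"
    and measurable: "X z \<in> measurable (P z) (path_algebra {0..})"
    and start: "AE \<omega> in P z. X z \<omega> 0 = Some z"
    and locally_constant:
      "0 \<le> t \<Longrightarrow>
        AE \<omega> in P z. X z \<omega> t \<noteq> None \<and> (\<forall>\<^sub>F s in at t within {0..}. X z \<omega> s = X z \<omega> t)"
    and right_constant:
      "AE \<omega> in P z. \<forall>t\<ge>0. X z \<omega> t \<noteq> None \<longrightarrow>
        (\<exists>\<epsilon>>0. \<forall>s\<in>{t..t + \<epsilon>}. X z \<omega> s = X z \<omega> t)"
    and exit_attained: "AE \<omega> in P z. has_minimum {t. 0 < t \<and> X z \<omega> t \<noteq> Some z}"
    and exit_indep:
      "prob_space.indep_set (P z)
        {(\<lambda>\<omega>. exit_time z (X z \<omega>)) -` S \<inter> space (P z) | S. S \<in> sets borel}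
        {(\<lambda>\<omega>. X z \<omega> (exit_time z (X z \<omega>))) -` S \<inter> space (P z) | S. S \<in> UNIV}"
    and exit_time_distributed:
      "distributed (P z) lborel (\<lambda>\<omega>. exit_time z (X z \<omega>)) (exponential_density (w z))"
    and exit_position:
      "x \<in> neighbours E z \<Longrightarrow>
        measure (P z) {\<omega> \<in> space (P z). X z \<omega> (exit_time z (X z \<omega>)) = Some x}
          = c {z, x} / total_conductance E c z"
    and markov:
      "0 \<le> t \<Longrightarrow> B \<in> sets (path_algebra {0..t}) \<Longrightarrow> C \<in> sets (path_algebra {0..}) \<Longrightarrow>
        measure (P z)
            {\<omega> \<in> space (P z). X z \<omega> \<in> B \<and> X z \<omega> t = Some x \<and> shift_path t (X z \<omega>) \<in> C}
          = measure (P z) {\<omega> \<in> space (P z). X z \<omega> \<in> B \<and> X z \<omega> t = Some x}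
            * measure (P x) {\<omega> \<in> space (P x). X x \<omega> \<in> C}"
    and recurrent: "AE \<omega> in P z. \<forall>T\<ge>0. \<exists>t\<ge>T. X z \<omega> t = Some z"
    and hitting_attained:
      "finite A \<Longrightarrow> A \<noteq> {} \<Longrightarrow> AE \<omega> in P z. has_minimum {t. 0 \<le> t \<and> X z \<omega> t \<in> Some ` A}"
    and energy_minimizer_hitting:
      "finite A \<Longrightarrow> A \<noteq> {} \<Longrightarrow>
        energy_minimizer E c A \<phi> z
          = (\<integral>\<omega>. \<phi> (the (X z \<omega> (hitting_time A (X z \<omega>)))) \<partial>P z)"

definition green ::
    "('v \<Rightarrow> 'w measure) \<Rightarrow> ('v \<Rightarrow> 'w \<Rightarrow> real \<Rightarrow> 'v option) \<Rightarrow> 'v set \<Rightarrow> 'v \<Rightarrow> 'v \<Rightarrow> ennreal"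
  where "green P X A x y = (\<integral>\<^sup>+\<omega>. visits_before A y (X x \<omega>) \<partial>P x)"

end

theory Submission
  imports Defs
begin

text \<open>
  A component of the set of times spent at \<open>y\<close> has positive length, so the number of visits is the
  limit of the number of points \<open>k / 2 ^ n\<close> of the dyadic grids at which the path sits at \<open>y\<close> but
  leaves \<open>y\<close> before the next grid point.  This count involves only fixed times, which is what the
  Markov property speaks about.

  Finiteness: choose \<open>M\<close> such that the walk from \<open>y\<close> hits \<open>A\<close> before time \<open>M\<close> with probability at
  least \<open>1 / 2\<close>.  Then the expected number of grid times spent at \<open>y\<close> before hitting \<open>A\<close> is at most
  \<open>2 M 2 ^ n\<close>, and each of them is counted with probability at most \<open>w y / 2 ^ n\<close>, so Fatou's lemma
  bounds the Green's function by \<open>2 M w y\<close>.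

  For \<open>x\<close> outside \<open>A\<close>, harmonicity and the equation at \<open>y\<close> are both the first-step equation
  \<open>G x y = [x = y] + (\<Sum>z. c {x, z} / \<pi> x * G z y)\<close>, which follows by applying the Markov property at
  the first grid point after the exit time from \<open>x\<close> and letting the mesh of the grid tend to \<open>0\<close>.
\<close>

section \<open>Counting visits on dyadic grids\<close>

text \<open>The condition of the axiom \<open>right_constant\<close> for a single path, so that
  visits can be counted path by path before any probability enters.\<close>

definition right_constant_path :: "(real \<Rightarrow> 'v option) \<Rightarrow> bool"
  where "right_constant_path p \<longleftrightarrow>
    (\<forall>t\<ge>0. p t \<noteq> None \<longrightarrow> (\<exists>\<epsilon>>0. \<forall>s\<in>{t..t + \<epsilon>}. p s = p t))"

definition stays :: "'v \<Rightarrow> real \<Rightarrow> real \<Rightarrow> (real \<Rightarrow> 'v option) set"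
  where "stays x a b = {p. \<forall>s\<in>{a..b}. p s = Some x}"

text \<open>Only rational times are tested, which makes the event a countable combination of
  coordinate events.\<close>

definition avoids :: "'v set \<Rightarrow> real \<Rightarrow> (real \<Rightarrow> 'v option) set"
  where "avoids A q = {p. \<forall>r\<in>\<rat>. 0 \<le> r \<and> r \<le> q \<longrightarrow> p r \<notin> Some ` A}"

text \<open>\<open>k / 2 ^ n\<close> is the last grid point of a visit. Leaving \<open>y\<close> and
  being back at the next grid point also ends the visit, because \<open>stays\<close> looks at the
  whole closed cell.\<close>

definition grid_visit :: "'v set \<Rightarrow> 'v \<Rightarrow> nat \<Rightarrow> nat \<Rightarrow> (real \<Rightarrow> 'v option) set"
  where "grid_visit A y n k =
    {p. p (k / 2 ^ n) = Some y} \<inter> avoids A (k / 2 ^ n) - stays y (k / 2 ^ n) (Suc k / 2 ^ n)"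

definition grid_count :: "'v set \<Rightarrow> 'v \<Rightarrow> nat \<Rightarrow> (real \<Rightarrow> 'v option) \<Rightarrow> ennreal"
  where "grid_count A y n p = (\<Sum>k. indicator (grid_visit A y n k) p)"

text \<open>On the paths of interest the grid counts converge to the number of visits. The
  \<open>liminf\<close> is defined and measurable on all paths and is the form that suits Fatou's
  lemma.\<close>

definition visit_count :: "'v set \<Rightarrow> 'v \<Rightarrow> (real \<Rightarrow> 'v option) \<Rightarrow> ennreal"
  where "visit_count A y p = liminf (\<lambda>n. grid_count A y n p)"

section \<open>Attained minima, right-constant paths and dyadic points\<close>

lemma has_minimum_Least:
  assumes "has_minimum {t. Q t}"
  shows "Q (LEAST t. Q t)" and "Q t \<Longrightarrow> (LEAST t. Q t) \<le> t"
proof -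
  obtain m where m: "Q m" "\<And>s. Q s \<Longrightarrow> m \<le> s"
    using assms by (auto simp: has_minimum_def)
  then have "(LEAST t. Q t) = m" by (intro Least_equality)
  with m show "Q (LEAST t. Q t)" "Q t \<Longrightarrow> (LEAST t. Q t) \<le> t" by auto
qed

lemma right_constant_pathE:
  assumes "right_constant_path p" "0 \<le> t" "p t = Some v"
  obtains \<epsilon> where "0 < \<epsilon>" "\<And>s. t \<le> s \<Longrightarrow> s \<le> t + \<epsilon> \<Longrightarrow> p s = Some v"
proof -
  have "p t \<noteq> None" using assms(3) by simp
  from assms(1)[unfolded right_constant_path_def, rule_format, OF assms(2) this]
  obtain \<epsilon> where \<epsilon>: "0 < \<epsilon>" "\<forall>s\<in>{t..t + \<epsilon>}. p s = p t" by blast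
  show thesis
  proof (rule that[OF \<epsilon>(1)])
    fix s assume "t \<le> s" "s \<le> t + \<epsilon>"
    then show "p s = Some v" using \<epsilon>(2) assms(3) by simp
  qed
qed

lemma grid_point_rational: "real k / 2 ^ n \<in> \<rat>"
  by (intro Rats_divide Rats_power) auto

lemma grid_point_in_interval:
  assumes "0 \<le> c" "1 / 2 ^ n \<le> \<epsilon>"
  obtains k :: nat where "c \<le> k / 2 ^ n" "k / 2 ^ n \<le> c + \<epsilon>"
proof -
  define k where "k = nat \<lceil>c * 2 ^ n\<rceil>"
  have "0 \<le> c * 2 ^ n" using assms(1) by simp
  then have "c * 2 ^ n \<le> k" "k \<le> c * 2 ^ n + 1"
    unfolding k_def by linarith+
  then have "c \<le> k / 2 ^ n" "k / 2 ^ n \<le> c + 1 / 2 ^ n"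
    by (simp_all add: field_simps)
  with assms(2) show thesis by (intro that[of k]) auto
qed

lemma eventually_inverse_power2_le:
  assumes "0 < (\<epsilon>::real)"
  shows "\<forall>\<^sub>F n in sequentially. 1 / 2 ^ n \<le> \<epsilon>"
proof -
  have "(\<lambda>n. (1/2::real) ^ n) \<longlonglongrightarrow> 0" by (rule LIMSEQ_realpow_zero) auto
  then have "\<forall>\<^sub>F n in sequentially. (1/2) ^ n < \<epsilon>" using assms by (rule order_tendstoD)
  then show ?thesis by eventually_elim (simp add: power_divide)
qed

text \<open>If \<open>A\<close> is hit before \<open>q\<close>, the path sits at the hit vertex for
  a while, so a rational time up to \<open>q\<close> detects it. If \<open>A\<close> is hit exactly
  at \<open>q\<close>, then \<open>q\<close> itself is a test time; this is where rationality of
  \<open>q\<close> enters.\<close>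

lemma avoids_iff_before_hitting_time:
  assumes p: "right_constant_path p" and min: "has_minimum {t. 0 \<le> t \<and> p t \<in> Some ` A}"
    and q: "0 \<le> q" "q \<in> \<rat>"
  shows "p \<in> avoids A q \<longleftrightarrow> q < hitting_time A p"
proof
  let ?T = "hitting_time A p"
  note T = has_minimum_Least[OF min, folded hitting_time_def]
  show "p \<in> avoids A q" if "q < ?T"
    unfolding avoids_def
  proof (intro CollectI ballI impI)
    fix r assume "0 \<le> r \<and> r \<le> q"
    then show "p r \<notin> Some ` A" using T(2)[of r] that by linarith
  qed
  assume av: "p \<in> avoids A q"
  show "q < ?T"
  proof (rule ccontr)
    assume "\<not> q < ?T"
    then consider "?T = q" | "?T < q" by linarith
    then show False
    proof cases
      case 1
      then show False using av T(1) q by (auto simp: avoids_def)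
    next
      case 2
      obtain a where a: "a \<in> A" "p ?T = Some a" using T(1) by auto
      obtain \<epsilon> where \<epsilon>: "0 < \<epsilon>" "\<And>s. ?T \<le> s \<Longrightarrow> s \<le> ?T + \<epsilon> \<Longrightarrow> p s = Some a"
        using right_constant_pathE[OF p _ a(2)] T(1) by blast
      obtain r where "r \<in> \<rat>" "?T < r" "r < min q (?T + \<epsilon>)"
        using Rats_dense_in_real[of ?T "min q (?T + \<epsilon>)"] 2 \<epsilon>(1) by auto
      with \<epsilon>(2)[of r] a av T(1) show False by (auto simp: avoids_def)
    qed
  qed
qed

section \<open>Grid visits compared with components of the occupation set\<close>

lemma grid_count_eq_emeasure:
  "grid_count A y n p = emeasure (count_space UNIV) {k. p \<in> grid_visit A y n k}"
proof -
  have "grid_count A y n p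
      = (\<integral>\<^sup>+k. indicator {k. p \<in> grid_visit A y n k} k \<partial>count_space UNIV)"
    by (simp add: grid_count_def nn_integral_count_space_nat indicator_def)
  then show ?thesis by simp
qed

lemma emeasure_count_space_le_inj_on:
  assumes "inj_on f K" "f ` K \<subseteq> L"
  shows "emeasure (count_space UNIV) K \<le> emeasure (count_space UNIV) L"
proof (cases "finite L")
  case True
  then show ?thesis
    using assms card_inj_on_le[OF assms True] finite_imageD[OF _ assms(1)] finite_subset[OF assms(2)]
    by (simp add: emeasure_count_space_finite)
qed simp

text \<open>For infinite \<open>L\<close> there are finite subsets of every size, which forces
  \<open>m\<close> to be infinite.\<close>

lemma emeasure_count_space_leI:
  assumes "\<And>F. finite F \<Longrightarrow> F \<subseteq> L \<Longrightarrow> of_nat (card F) \<le> m"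
  shows "emeasure (count_space UNIV) L \<le> m"
proof (cases "finite L")
  case True
  then show ?thesis using assms[of L] by simp
next
  case False
  have "of_nat k \<le> m" for k
    using infinite_arbitrarily_large[OF False, of k] assms by auto
  then have "(SUP k. of_nat k) \<le> m" by (rule SUP_least)
  then show ?thesis by (simp add: ennreal_SUP_of_nat_eq_top top_unique)
qed

text \<open>Different grid visits lie in different components: a component is an interval, so one
  containing two of them would contain the cell after the earlier one, and the path would stay at
  \<open>y\<close> throughout that cell.\<close>

lemma grid_count_le_visits_before:
  assumes p: "right_constant_path p" and min: "has_minimum {t. 0 \<le> t \<and> p t \<in> Some ` A}"
  shows "grid_count A y n p \<le> visits_before A y p"
proof -
  let ?S = "{t \<in> {0..<hitting_time A p}. p t = Some y}"
  let ?f = "\<lambda>k::nat. connected_component_set ?S (k / 2 ^ n)"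
  have S: "real k / 2 ^ n \<in> ?S" if "p \<in> grid_visit A y n k" for k
    using that avoids_iff_before_hitting_time[OF p min _ grid_point_rational]
    by (auto simp: grid_visit_def)
  have ne: "?f k \<noteq> ?f k'" if "p \<in> grid_visit A y n k" "p \<in> grid_visit A y n k'" "k < k'" for k k'
  proof
    assume "?f k = ?f k'"
    then have "connected_component ?S (k / 2 ^ n) (k' / 2 ^ n)"
      using S[OF that(2)] by (metis (no_types, lifting) connected_component_refl mem_Collect_eq)
    then have "closed_segment (k / 2 ^ n) (k' / 2 ^ n) \<subseteq> ?S"
      by (simp only: connected_component_1)
    moreover have "k / 2 ^ n \<le> k' / (2::real) ^ n"
      using that(3) by (intro divide_right_mono) auto
    ultimately have "{k / 2 ^ n..k' / 2 ^ n} \<subseteq> ?S"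
      by (simp only: closed_segment_eq_real_ivl if_True)
    moreover have "Suc k / 2 ^ n \<le> k' / (2::real) ^ n"
      using that(3) by (intro divide_right_mono) auto
    ultimately have "p \<in> stays y (k / 2 ^ n) (Suc k / 2 ^ n)"
      by (fastforce simp: stays_def)
    with that(1) show False by (simp add: grid_visit_def)
  qed
  have "inj_on ?f {k. p \<in> grid_visit A y n k}"
    using ne by (intro linorder_inj_onI') auto
  moreover have "?f ` {k. p \<in> grid_visit A y n k} \<subseteq> components ?S"
    using S by (auto simp: components_def)
  ultimately show ?thesis
    unfolding grid_count_eq_emeasure visits_before_def by (rule emeasure_count_space_le_inj_on)
qed

text \<open>The grid visit attached to a component is its last grid point.\<close>

lemma eventually_component_has_grid_visit:
  assumes p: "right_constant_path p" and min: "has_minimum {t. 0 \<le> t \<and> p t \<in> Some ` A}"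
    and C: "C \<in> components {t \<in> {0..<hitting_time A p}. p t = Some y}"
  shows "\<forall>\<^sub>F n in sequentially. \<exists>k. p \<in> grid_visit A y n k \<and> real k / 2 ^ n \<in> C"
proof -
  let ?T = "hitting_time A p"
  let ?S = "{t \<in> {0..<?T}. p t = Some y}"
  note T = has_minimum_Least[OF min, folded hitting_time_def]
  obtain c where c: "c \<in> ?S" and C_eq: "C = connected_component_set ?S c"
    using C by (auto simp: components_def)
  have y: "y \<notin> A" using c T(2)[of c] by auto
  obtain \<epsilon> where \<epsilon>: "0 < \<epsilon>" "\<And>s. c \<le> s \<Longrightarrow> s \<le> c + \<epsilon> \<Longrightarrow> p s = Some y"
    using right_constant_pathE[OF p, of c y] c by auto
  \<comment> \<open>A stretch spent at \<open>y\<close> cannot run across the hitting time, since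
    \<open>y\<close> is not in \<open>A\<close>.\<close>
  have extend: "{c..b} \<subseteq> ?S" if "\<And>s. c \<le> s \<Longrightarrow> s \<le> b \<Longrightarrow> p s = Some y" for b
  proof
    fix s assume s: "s \<in> {c..b}"
    have "s < ?T"
    proof (rule ccontr)
      assume "\<not> s < ?T"
      then have "p ?T = Some y" using that s c by auto
      with T(1) y show False by auto
    qed
    with s that c show "s \<in> ?S" by auto
  qed
  show ?thesis
    using eventually_inverse_power2_le[OF \<epsilon>(1)]
  proof eventually_elim
    case (elim n)
    \<comment> \<open>The grid points reachable from \<open>c\<close> to the right inside
      \<open>?S\<close>; the largest index, finite because of the hitting time, is the grid visit
      sought.\<close>
    let ?K = "{k::nat. c \<le> k / 2 ^ n \<and> {c..k / 2 ^ n} \<subseteq> ?S}"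
    obtain k0 :: nat where k0: "c \<le> k0 / 2 ^ n" "k0 / 2 ^ n \<le> c + \<epsilon>"
      using grid_point_in_interval[OF _ elim, of c] c by auto
    have "k0 \<in> ?K" using k0 extend[of "k0 / 2 ^ n"] \<epsilon>(2) by auto
    have "finite ?K"
    proof (rule finite_subset)
      show "?K \<subseteq> {..nat \<lceil>?T * 2 ^ n\<rceil>}"
      proof
        fix k assume "k \<in> ?K"
        then have "k / 2 ^ n < ?T" by (auto simp: subset_iff)
        then have "real k < ?T * 2 ^ n" by (simp add: field_simps)
        then show "k \<in> {..nat \<lceil>?T * 2 ^ n\<rceil>}" by simp linarith
      qed
    qed simp
    define k where "k = Max ?K"
    have k: "k \<in> ?K" "\<And>k'. k' \<in> ?K \<Longrightarrow> k' \<le> k"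
      unfolding k_def using Max_in[OF \<open>finite ?K\<close>] Max_ge[OF \<open>finite ?K\<close>] \<open>k0 \<in> ?K\<close> by auto
    have kS: "k / 2 ^ n \<in> ?S" using k(1) by auto
    have "p \<notin> stays y (k / 2 ^ n) (Suc k / 2 ^ n)"
    proof
      assume st: "p \<in> stays y (k / 2 ^ n) (Suc k / 2 ^ n)"
      have "{c..Suc k / 2 ^ n} \<subseteq> ?S"
      proof (rule extend)
        fix s assume s: "c \<le> s" "s \<le> Suc k / 2 ^ n"
        show "p s = Some y"
        proof (cases "s \<le> k / 2 ^ n")
          case True
          with s k(1) show ?thesis by auto
        next
          case False
          with s st show ?thesis by (auto simp: stays_def)
        qed
      qed
      moreover have "c \<le> Suc k / 2 ^ n" using k(1) by (auto simp: field_simps)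
      ultimately have "Suc k \<in> ?K" by auto
      from k(2)[OF this] show False by simp
    qed
    moreover have "p \<in> avoids A (k / 2 ^ n)"
      using kS avoids_iff_before_hitting_time[OF p min _ grid_point_rational] by auto
    ultimately have "p \<in> grid_visit A y n k" using kS by (simp add: grid_visit_def)
    moreover have "k / 2 ^ n \<in> C"
      using k(1) by (auto simp: C_eq connected_component_1 closed_segment_eq_real_ivl)
    ultimately show ?case by blast
  qed
qed

text \<open>The grid counts never exceed the number of components. Conversely, all sufficiently fine
  grids see every member of a given finite set of components, and disjointness of components makes
  the grid visits found in them distinct.\<close>

lemma visits_before_eq_visit_count:
  assumes p: "right_constant_path p" and min: "has_minimum {t. 0 \<le> t \<and> p t \<in> Some ` A}"
  shows "visits_before A y p = visit_count A y p"
proof (rule antisym)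
  let ?comps = "components {t \<in> {0..<hitting_time A p}. p t = Some y}"
  show "visits_before A y p \<le> visit_count A y p"
    unfolding visits_before_def
  proof (rule emeasure_count_space_leI)
    fix F assume F: "finite F" "F \<subseteq> ?comps"
    have "\<forall>\<^sub>F n in sequentially. \<forall>C\<in>F. \<exists>k. p \<in> grid_visit A y n k \<and> real k / 2 ^ n \<in> C"
    proof (rule eventually_ball_finite[OF F(1)], rule ballI)
      fix C assume "C \<in> F"
      with F(2) have "C \<in> ?comps" by blast
      then show "\<forall>\<^sub>F n in sequentially. \<exists>k. p \<in> grid_visit A y n k \<and> real k / 2 ^ n \<in> C"
        by (rule eventually_component_has_grid_visit[OF p min])
    qed
    then have "\<forall>\<^sub>F n in sequentially. of_nat (card F) \<le> grid_count A y n p"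
    proof eventually_elim
      case (elim n)
      then obtain f where f: "\<And>C. C \<in> F \<Longrightarrow> p \<in> grid_visit A y n (f C) \<and> real (f C) / 2 ^ n \<in> C"
        by metis
      have "inj_on f F"
      proof (rule inj_onI)
        fix C D assume "C \<in> F" "D \<in> F" "f C = f D"
        then have "real (f C) / 2 ^ n \<in> C \<inter> D" using f by force
        moreover have "C \<in> ?comps" "D \<in> ?comps" using \<open>C \<in> F\<close> \<open>D \<in> F\<close> F(2) by blast+
        ultimately show "C = D" using components_nonoverlap[of C "{t \<in> {0..<hitting_time A p}. p t = Some y}" D] by (metis empty_iff)
      qed
      then have "emeasure (count_space UNIV) F
          \<le> emeasure (count_space UNIV) {k. p \<in> grid_visit A y n k}"
        using f by (intro emeasure_count_space_le_inj_on[of f]) auto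
      then show ?case using F(1) by (simp add: grid_count_eq_emeasure)
    qed
    then show "of_nat (card F) \<le> visit_count A y p"
      unfolding visit_count_def by (rule Liminf_bounded)
  qed
  show "visit_count A y p \<le> visits_before A y p"
    unfolding visit_count_def
    using grid_count_le_visits_before[OF p min]
    by (intro Liminf_le always_eventually) auto
qed

section \<open>Shifting a path past its first jump\<close>

lemma avoids_shift_iff:
  assumes x: "x \<notin> A" and \<tau>: "\<And>s. 0 \<le> s \<Longrightarrow> s < \<tau> \<Longrightarrow> p s = Some x"
    and z: "\<And>s. \<tau> \<le> s \<Longrightarrow> s \<le> \<sigma> \<Longrightarrow> p s = Some z"
    and \<sigma>: "\<sigma> \<in> \<rat>" "0 < \<tau>" "\<tau> \<le> \<sigma>" and a: "0 \<le> a"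
  shows "p \<in> avoids A (a + \<sigma>) \<longleftrightarrow> shift_path \<sigma> p \<in> avoids A a"
proof
  assume *: "p \<in> avoids A (a + \<sigma>)"
  show "shift_path \<sigma> p \<in> avoids A a"
    unfolding avoids_def
  proof (intro CollectI ballI impI)
    fix r :: real assume "r \<in> \<rat>" "0 \<le> r \<and> r \<le> a"
    \<comment> \<open>Rationality of \<open>\<sigma>\<close> keeps the test times rational under the
      shift.\<close>
    then have "r + \<sigma> \<in> \<rat>" "0 \<le> r + \<sigma>" "r + \<sigma> \<le> a + \<sigma>"
      using \<sigma> by auto
    with * show "shift_path \<sigma> p r \<notin> Some ` A" unfolding avoids_def shift_path_def by blast
  qed
next
  assume *: "shift_path \<sigma> p \<in> avoids A a"
  then have shift: "p (r + \<sigma>) \<notin> Some ` A" if "r \<in> \<rat>" "0 \<le> r" "r \<le> a" for r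
    using that unfolding avoids_def shift_path_def by blast
  \<comment> \<open>Time 0 of the shifted path tests \<open>z\<close>. Up to \<open>\<sigma>\<close>
    the path meets only \<open>x\<close> and \<open>z\<close>, so no earlier time can hit
    \<open>A\<close>.\<close>
  have "z \<notin> A" using shift[of 0] z[of \<sigma>] \<sigma> a by auto
  show "p \<in> avoids A (a + \<sigma>)"
    unfolding avoids_def
  proof (intro CollectI ballI impI)
    fix r :: real assume r: "r \<in> \<rat>" "0 \<le> r \<and> r \<le> a + \<sigma>"
    consider "r < \<tau>" | "\<tau> \<le> r" "r \<le> \<sigma>" | "\<sigma> \<le> r" by linarith
    then show "p r \<notin> Some ` A"
    proof cases
      case 1
      then show ?thesis using \<tau>[of r] r x by auto
    next
      case 2
      then show ?thesis using z[of r] \<open>z \<notin> A\<close> by auto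
    next
      case 3
      then show ?thesis using shift[of "r - \<sigma>"] r \<sigma> by auto
    qed
  qed
qed

lemma stays_shift_iff: "shift_path \<sigma> p \<in> stays y a b \<longleftrightarrow> p \<in> stays y (a + \<sigma>) (b + \<sigma>)"
proof -
  have "(\<forall>s\<in>{a..b}. p (s + \<sigma>) = Some y) \<longleftrightarrow> (\<forall>s\<in>(\<lambda>s. s + \<sigma>) ` {a..b}. p s = Some y)"
    by blast
  then show ?thesis by (simp add: stays_def shift_path_def)
qed

text \<open>The shift time is a point of every grid finer than the \<open>n\<close>-th one, so the grids before
  and after the shift match up.\<close>

lemma visit_count_shift:
  assumes x: "x \<notin> A" "x \<noteq> z" and \<tau>: "\<And>s. 0 \<le> s \<Longrightarrow> s < \<tau> \<Longrightarrow> p s = Some x"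
    and z: "\<And>s. \<tau> \<le> s \<Longrightarrow> s \<le> \<sigma> \<Longrightarrow> p s = Some z"
    and \<sigma>: "\<sigma> = real K / 2 ^ n" "0 < \<tau>" "\<tau> \<le> \<sigma>"
  shows "visit_count A y p = (if x = y then 1 else 0) + visit_count A y (shift_path \<sigma> p)"
proof -
  let ?\<delta> = "if x = y then 1 else 0 :: ennreal"
  have rat: "\<sigma> \<in> \<rat>" unfolding \<sigma>(1) by (rule grid_point_rational)
  have count: "grid_count A y m p = ?\<delta> + grid_count A y m (shift_path \<sigma> p)" if "n \<le> m" for m
  proof -
    \<comment> \<open>The index of the time \<open>\<sigma>\<close> in the \<open>m\<close>-th
      grid.\<close>
    define L where "L = K * 2 ^ (m - n)"
    have L: "real L / 2 ^ m = \<sigma>"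
      using that by (simp add: L_def \<sigma>(1) field_simps flip: power_add)
    have grid: "real (k + L) / 2 ^ m = k / 2 ^ m + \<sigma>" for k
      by (simp add: L[symmetric] add_divide_distrib)
    have late: "p \<in> grid_visit A y m (k + L) \<longleftrightarrow> shift_path \<sigma> p \<in> grid_visit A y m k" for k
    proof -
      have "p \<in> avoids A (k / 2 ^ m + \<sigma>) \<longleftrightarrow> shift_path \<sigma> p \<in> avoids A (k / 2 ^ m)"
        using avoids_shift_iff[OF x(1) \<tau> z rat \<sigma>(2,3)] by simp
      moreover have "real (Suc (k + L)) / 2 ^ m = Suc k / 2 ^ m + \<sigma>"
        using grid[of "Suc k"] by simp
      ultimately show ?thesis
        unfolding grid_visit_def grid by (simp add: stays_shift_iff) (simp add: shift_path_def)
    qed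
    \<comment> \<open>The last grid index strictly before \<open>\<tau>\<close>; if
      \<open>\<tau>\<close> is a grid point, it belongs to the cell that ends there.\<close>
    define k0 where "k0 = nat (\<lceil>\<tau> * 2 ^ m\<rceil> - 1)"
    have "1 \<le> \<lceil>\<tau> * 2 ^ m\<rceil>" using \<sigma>(2) by (simp add: ceiling_le_iff)
    then have k0: "k0 < \<tau> * 2 ^ m" "\<tau> * 2 ^ m \<le> Suc k0"
      unfolding k0_def by linarith+
    have k0_iff: "k / 2 ^ m < \<tau> \<and> \<tau> \<le> Suc k / 2 ^ m \<longleftrightarrow> k = k0" for k :: nat
    proof -
      have "k / 2 ^ m < \<tau> \<and> \<tau> \<le> Suc k / 2 ^ m \<longleftrightarrow> k < \<tau> * 2 ^ m \<and> \<tau> * 2 ^ m \<le> Suc k"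
        by (simp add: field_simps)
      also have "\<dots> \<longleftrightarrow> k = k0" using k0 by auto
      finally show ?thesis .
    qed
    have "\<tau> * 2 ^ m \<le> L" using \<sigma>(3) L by (simp add: field_simps)
    then have "k0 < L" using k0(1) by linarith
    \<comment> \<open>Before \<open>\<sigma>\<close> only the departure from \<open>x\<close> can
      count, and it does so exactly if \<open>x = y\<close>. The later cells lie within the stay at
      \<open>z\<close>, so they give no grid visit even if \<open>z = y\<close>.\<close>
    have early: "p \<in> grid_visit A y m k \<longleftrightarrow> x = y \<and> k = k0" if "k < L" for k
    proof -
      have "Suc k / 2 ^ m \<le> real L / 2 ^ m" using that by (intro divide_right_mono) auto
      then have k: "Suc k / 2 ^ m \<le> \<sigma>" "k / 2 ^ m \<le> Suc k / (2::real) ^ m"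
        by (simp_all add: L divide_right_mono)
      show ?thesis
      proof (cases "k / 2 ^ m < \<tau>")
        case True
        have "p (k / 2 ^ m) = Some x" using \<tau> True by simp
        moreover have "p r \<notin> Some ` A" if "0 \<le> r" "r \<le> k / 2 ^ m" for r
          using \<tau>[of r] that True x(1) by auto
        then have "p \<in> avoids A (k / 2 ^ m)" by (simp add: avoids_def)
        moreover have "p \<in> stays x (k / 2 ^ m) (Suc k / 2 ^ m) \<longleftrightarrow> Suc k / 2 ^ m < \<tau>"
        proof
          assume "p \<in> stays x (k / 2 ^ m) (Suc k / 2 ^ m)"
          then have "p (Suc k / 2 ^ m) = Some x" using k(2) by (auto simp: stays_def)
          then show "Suc k / 2 ^ m < \<tau>" using z[OF _ k(1)] x(2) by force
        next
          assume "Suc k / 2 ^ m < \<tau>"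
          then show "p \<in> stays x (k / 2 ^ m) (Suc k / 2 ^ m)"
            unfolding stays_def
            by (intro CollectI ballI \<tau>) (auto intro: order_trans[rotated])
        qed
        ultimately have "p \<in> grid_visit A y m k \<longleftrightarrow> x = y \<and> \<tau> \<le> Suc k / 2 ^ m"
          by (auto simp: grid_visit_def not_less)
        then show ?thesis using k0_iff[of k] True by simp
      next
        case False
        then have "p s = Some z" if "s \<in> {k / 2 ^ m..Suc k / 2 ^ m}" for s
          using that k(1) by (intro z) auto
        then have "p \<notin> grid_visit A y m k" using k(2) by (auto simp: grid_visit_def stays_def)
        moreover have "k \<noteq> k0" using k0_iff[of k] False by blast
        ultimately show ?thesis by simp
      qed
    qed
    have "(\<Sum>k<L. indicator (grid_visit A y m k) p) = (\<Sum>k<L. if k = k0 then ?\<delta> else 0)"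
      by (intro sum.cong refl) (simp add: early indicator_def)
    also have "\<dots> = ?\<delta>" using \<open>k0 < L\<close> by simp
    finally have "(\<Sum>k<L. indicator (grid_visit A y m k) p) = ?\<delta>" .
    then have "grid_count A y m p = (\<Sum>k. indicator (grid_visit A y m (k + L)) p) + ?\<delta>"
      unfolding grid_count_def by (subst suminf_offset[where i = L]) auto
    also have "(\<Sum>k. indicator (grid_visit A y m (k + L)) p) = grid_count A y m (shift_path \<sigma> p)"
      unfolding grid_count_def by (simp add: late indicator_def)
    finally show ?thesis by (simp add: add.commute)
  qed
  have "visit_count A y p = liminf (\<lambda>m. ?\<delta> + grid_count A y m (shift_path \<sigma> p))"
    unfolding visit_count_def
    by (intro Liminf_eq eventually_sequentiallyI[of n] count)
  also have "\<dots> = ?\<delta> + visit_count A y (shift_path \<sigma> p)"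
    unfolding visit_count_def
    by (intro Liminf_compose_continuous_mono continuous_on_add_ennreal continuous_intros)
      (auto simp: mono_def add_left_mono)
  finally show ?thesis .
qed

section \<open>Measurability in the path algebra\<close>

lemma space_path_algebra [simp]: "space (path_algebra T) = UNIV"
  by (simp add: path_algebra_def)

lemma sets_path_algebra:
  "sets (path_algebra T) = sigma_sets UNIV {stays x a b | a b x. a \<le> b \<and> {a..b} \<subseteq> T}"
  by (simp add: path_algebra_def stays_def)

lemma sets_path_algebra_mono: "S \<subseteq> T \<Longrightarrow> sets (path_algebra S) \<subseteq> sets (path_algebra T)"
  unfolding sets_path_algebra by (intro sigma_sets_mono') blast

lemma stays_in_path_algebra:
  "a \<le> b \<Longrightarrow> {a..b} \<subseteq> T \<Longrightarrow> stays x a b \<in> sets (path_algebra T)"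
  unfolding sets_path_algebra by (rule sigma_sets.Basic) blast

lemma coordinate_in_path_algebra:
  assumes "t \<in> T"
  shows "{p. p t = Some x} \<in> sets (path_algebra T)"
proof -
  have "{p. p t = Some x} = stays x t t" by (auto simp: stays_def)
  then show ?thesis using assms by (simp add: stays_in_path_algebra)
qed

lemma avoids_in_path_algebra:
  assumes "finite A"
  shows "avoids A q \<in> sets (path_algebra {0..q})"
proof -
  have "avoids A q = space (path_algebra {0..q}) - (\<Union>r\<in>\<rat> \<inter> {0..q}. \<Union>a\<in>A. {p. p r = Some a})"
    by (auto simp: avoids_def)
  also have "\<dots> \<in> sets (path_algebra {0..q})"
    by (intro sets.Diff sets.top sets.countable_UN'' sets.finite_UN assms
        coordinate_in_path_algebra countable_Int1 countable_rat) auto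
  finally show ?thesis .
qed

lemma avoids_in_path_algebra_UNIV:
  assumes "finite A"
  shows "avoids A q \<in> sets (path_algebra {0..})"
  using avoids_in_path_algebra[OF assms] sets_path_algebra_mono[of "{0..q}" "{0..}"] by auto

lemma grid_visit_in_path_algebra:
  assumes "finite A"
  shows "grid_visit A y n k \<in> sets (path_algebra {0..})"
  unfolding grid_visit_def
proof (intro sets.Diff sets.Int avoids_in_path_algebra_UNIV[OF assms] coordinate_in_path_algebra
    stays_in_path_algebra)
  show "real k / 2 ^ n \<le> real (Suc k) / 2 ^ n" by (simp add: divide_right_mono)
  have "0 \<le> real k / 2 ^ n" by simp
  then show "{real k / 2 ^ n..real (Suc k) / 2 ^ n} \<subseteq> {0..}" by auto
qed simp

lemma borel_measurable_grid_count:
  assumes "finite A"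
  shows "grid_count A y n \<in> borel_measurable (path_algebra {0..})"
proof -
  have [measurable]: "grid_visit A y n k \<in> sets (path_algebra {0..})" for k
    by (rule grid_visit_in_path_algebra[OF assms])
  show ?thesis unfolding grid_count_def[abs_def] by measurable
qed

lemma borel_measurable_visit_count:
  assumes "finite A"
  shows "visit_count A y \<in> borel_measurable (path_algebra {0..})"
  unfolding visit_count_def[abs_def]
  by (intro borel_measurable_liminf borel_measurable_grid_count assms)

lemma measurable_shift_path:
  assumes "0 \<le> t"
  shows "shift_path t \<in> measurable (path_algebra {0..}) (path_algebra {0..})"
  unfolding path_algebra_def[of "{0..}"]
proof (rule measurable_measure_of)
  fix S :: "(real \<Rightarrow> 'a option) set"
  assume "S \<in> {{p. \<forall>s\<in>{a..b}. p s = Some x} |a b x. a \<le> b \<and> {a..b} \<subseteq> {0..}}"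
  then obtain a b x where S: "S = stays x a b" "a \<le> b" "{a..b} \<subseteq> {0..}"
    by (auto simp: stays_def)
  have "shift_path t -` S = stays x (a + t) (b + t)"
    using stays_shift_iff[of t _ x a b] by (auto simp: S(1))
  also have "\<dots> \<in> sets (path_algebra {0..})"
    using S(2,3) assms by (intro stays_in_path_algebra) auto
  finally show "shift_path t -` S
      \<inter> space (sigma UNIV {{p. \<forall>s\<in>{a..b}. p s = Some x} |a b x. a \<le> b \<and> {a..b} \<subseteq> {0..}})
    \<in> sets (sigma UNIV {{p. \<forall>s\<in>{a..b}. p s = Some x} |a b x. a \<le> b \<and> {a..b} \<subseteq> {0..}})"
    by (simp add: path_algebra_def)
qed auto

section \<open>Finiteness of the Green's function\<close>

text \<open>Telescoping with step \<open>m\<close>: only the first \<open>m\<close> terms and the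
  \<open>m\<close> terms from index \<open>n\<close> on survive.\<close>

lemma sum_shifted_difference_le:
  fixes b :: "nat \<Rightarrow> real"
  assumes "\<And>k. 0 \<le> b k" "\<And>k. b k \<le> 1"
  shows "(\<Sum>k<n. b k - b (k + m)) \<le> m"
proof -
  have "(\<Sum>k<n. b k - b (k + m)) = (\<Sum>k<m. b k) - (\<Sum>k<m. b (n + k))"
  proof (induction n)
    case (Suc n)
    have "(\<Sum>k<m. b (n + k)) - (\<Sum>k<m. b (Suc n + k)) = b n - b (n + m)"
      using sum_lessThan_telescope'[of "\<lambda>k. b (n + k)" m] by (simp add: sum_subtractf)
    with Suc show ?case by simp
  qed simp
  also have "\<dots> \<le> (\<Sum>k<m. 1) - (\<Sum>k<m. 0)"
    by (intro diff_mono sum_mono assms)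
  finally show ?thesis by simp
qed

lemma avoids_antimono: "q \<le> r \<Longrightarrow> avoids A r \<subseteq> avoids A q"
  by (auto simp: avoids_def)

lemma Compl_in_path_algebra: "C \<in> sets (path_algebra T) \<Longrightarrow> - C \<in> sets (path_algebra T)"
  using sets.compl_sets[of C "path_algebra T"] by (simp add: Compl_eq_Diff_UNIV)

context reflected_walk
begin

lemma path_event:
  assumes "C \<in> sets (path_algebra {0..})"
  shows "{\<omega> \<in> space (P z). X z \<omega> \<in> C} \<in> sets (P z)"
  using measurable_sets[OF measurable assms] by (simp add: vimage_def Int_def conj_commute)

lemma AE_right_constant_path: "AE \<omega> in P z. right_constant_path (X z \<omega>)"
  using right_constant unfolding right_constant_path_def .

text \<open>Replaces the count of components by a functional measurable in the path algebra, to
  which Fatou's lemma and the Markov property apply.\<close>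

lemma green_eq_visit_count:
  assumes "finite A" "A \<noteq> {}"
  shows "green P X A x y = (\<integral>\<^sup>+\<omega>. visit_count A y (X x \<omega>) \<partial>P x)"
  unfolding green_def
proof (rule nn_integral_cong_AE)
  show "AE \<omega> in P x. visits_before A y (X x \<omega>) = visit_count A y (X x \<omega>)"
    using AE_right_constant_path hitting_attained[OF assms]
    by eventually_elim (rule visits_before_eq_visit_count)
qed

text \<open>\<open>A\<close> is almost surely hit at a finite time, so the decreasing events of
  avoiding it up to time \<open>M\<close> shrink to a null set.\<close>

lemma exists_half_hitting_time:
  assumes A: "finite A" "A \<noteq> {}"
  shows "\<exists>M::nat. measure (P y) {\<omega> \<in> space (P y). X y \<omega> \<in> avoids A M} \<le> 1 / 2"
proof -
  interpret prob_space "P y" by (rule prob_space)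
  let ?F = "\<lambda>M::nat. {\<omega> \<in> space (P y). X y \<omega> \<in> avoids A M}"
  have ev: "?F M \<in> sets (P y)" for M
    by (intro path_event avoids_in_path_algebra_UNIV A)
  have "decseq ?F"
  proof (rule decseq_SucI)
    fix M :: nat
    have "avoids A (Suc M) \<subseteq> avoids A M" by (rule avoids_antimono) simp
    then show "?F (Suc M) \<subseteq> ?F M" by blast
  qed
  then have "(\<lambda>M. measure (P y) (?F M)) \<longlonglongrightarrow> measure (P y) (\<Inter>M. ?F M)"
    using ev by (intro finite_Lim_measure_decseq) auto
  moreover have "measure (P y) (\<Inter>M. ?F M) = 0"
  proof -
    have "AE \<omega> in P y. \<omega> \<notin> (\<Inter>M. ?F M)"
      using AE_right_constant_path hitting_attained[OF A]
    proof eventually_elim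
      case (elim \<omega>)
      obtain M :: nat where "hitting_time A (X y \<omega>) \<le> M" using real_arch_simple by blast
      then have "X y \<omega> \<notin> avoids A M"
        using avoids_iff_before_hitting_time[OF elim, of M] by auto
      then show ?case by blast
    qed
    then show ?thesis using ev by (subst prob_eq_0) auto
  qed
  ultimately have "\<forall>\<^sub>F M in sequentially. measure (P y) (?F M) < 1 / 2"
    by (intro order_tendstoD) auto
  then obtain M where "measure (P y) (?F M) < 1 / 2"
    by (meson eventually_happens trivial_limit_sequentially)
  then show ?thesis by (intro exI[of _ M]) simp
qed

text \<open>Not staying at \<open>y\<close> until time \<open>h\<close> forces the exponential exit
  time to be at most \<open>h\<close>, and \<open>1 - exp (- h * w y)\<close> is at most
  \<open>w y * h\<close>.\<close>

lemma prob_not_stays_le: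
  assumes "0 < h"
  shows "measure (P y) {\<omega> \<in> space (P y). X y \<omega> \<notin> stays y 0 h} \<le> w y * h"
proof -
  interpret prob_space "P y" by (rule prob_space)
  have exp: "measure (P y) {\<omega> \<in> space (P y). exit_time y (X y \<omega>) \<le> h} = 1 - exp (- h * w y)"
    using exit_time_distributed[of y] rate_pos[of y] assms by (intro exponential_distributedD_le) auto
  have "AE \<omega> in P y. \<omega> \<in> {\<omega> \<in> space (P y). X y \<omega> \<notin> stays y 0 h}
      \<longrightarrow> \<omega> \<in> {\<omega> \<in> space (P y). exit_time y (X y \<omega>) \<le> h}"
    using start exit_attained
  proof eventually_elim
    case (elim \<omega>)
    show ?case
    proof (intro impI)
      assume *: "\<omega> \<in> {\<omega> \<in> space (P y). X y \<omega> \<notin> stays y 0 h}"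
      then obtain s where s: "0 \<le> s" "s \<le> h" "X y \<omega> s \<noteq> Some y" by (auto simp: stays_def)
      with elim(1) have "0 < s" by (cases "s = 0") auto
      then have "exit_time y (X y \<omega>) \<le> s"
        using has_minimum_Least(2)[OF elim(2), of s] s(3) by (simp add: exit_time_def)
      with s(2) * show "\<omega> \<in> {\<omega> \<in> space (P y). exit_time y (X y \<omega>) \<le> h}" by auto
    qed
  qed
  moreover have "{\<omega> \<in> space (P y). exit_time y (X y \<omega>) \<le> h} \<in> sets (P y)"
    using distributed_measurable[OF exit_time_distributed[of y]] by measurable
  ultimately have "measure (P y) {\<omega> \<in> space (P y). X y \<omega> \<notin> stays y 0 h} \<le> 1 - exp (- h * w y)"
    unfolding exp[symmetric] by (rule finite_measure_mono_AE)
  also have "\<dots> \<le> w y * h" using exp_ge_add_one_self[of "- h * w y"] by (simp add: mult.commute)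
  finally show ?thesis .
qed

text \<open>Each grid time at which the walk sits at \<open>y\<close> before hitting \<open>A\<close> is followed, with probability
  at least \<open>1 / 2\<close>, by the hitting of \<open>A\<close> within time \<open>M\<close>, and \<open>A\<close> is hit for the first time in at
  most \<open>M * 2 ^ n\<close> of the intervals of length \<open>M\<close> starting at grid points.\<close>

lemma grid_occupation_le:
  fixes M n N :: nat
  assumes A: "finite A"
    and M: "measure (P y) {\<omega> \<in> space (P y). X y \<omega> \<in> avoids A M} \<le> 1 / 2"
  shows "(\<Sum>k<N. measure (P x)
      {\<omega> \<in> space (P x). X x \<omega> \<in> avoids A (k / 2 ^ n) \<and> X x \<omega> (k / 2 ^ n) = Some y}) \<le> 2 * (M * 2 ^ n)"
proof -
  interpret x: prob_space "P x" by (rule prob_space)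
  interpret y: prob_space "P y" by (rule prob_space)
  define a where "a k = measure (P x)
    {\<omega> \<in> space (P x). X x \<omega> \<in> avoids A (k / 2 ^ n) \<and> X x \<omega> (k / 2 ^ n) = Some y}" for k :: nat
  define b where "b k = measure (P x) {\<omega> \<in> space (P x). X x \<omega> \<in> avoids A (k / 2 ^ n)}" for k :: nat
  \<comment> \<open>The number of grid steps that make up a time span of length
    \<open>M\<close>.\<close>
  define m where "m = M * 2 ^ n"
  have ev: "{\<omega> \<in> space (P x). X x \<omega> \<in> avoids A q} \<in> sets (P x)" for q
    by (intro path_event avoids_in_path_algebra_UNIV A)
  have hit: "- avoids A M \<in> sets (path_algebra {0..})"
    by (intro Compl_in_path_algebra avoids_in_path_algebra_UNIV A)
  have "{\<omega> \<in> space (P y). X y \<omega> \<in> - avoids A M}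
      = space (P y) - {\<omega> \<in> space (P y). X y \<omega> \<in> avoids A M}" by auto
  then have half: "1 / 2 \<le> measure (P y) {\<omega> \<in> space (P y). X y \<omega> \<in> - avoids A M}"
    using M y.prob_compl[OF path_event[OF avoids_in_path_algebra_UNIV[OF A, of M]]] by simp
  have step: "a k / 2 \<le> b k - b (k + m)" for k
  proof -
    have t: "real (k + m) / 2 ^ n = M + k / 2 ^ n" by (simp add: m_def field_simps)
    have "a k / 2 \<le> a k * measure (P y) {\<omega> \<in> space (P y). X y \<omega> \<in> - avoids A M}"
      using mult_left_mono[OF half, of "a k"] by (simp add: a_def)
    also have "\<dots> = measure (P x) {\<omega> \<in> space (P x). X x \<omega> \<in> avoids A (k / 2 ^ n)
        \<and> X x \<omega> (k / 2 ^ n) = Some y \<and> shift_path (k / 2 ^ n) (X x \<omega>) \<in> - avoids A M}"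
      unfolding a_def by (rule markov[OF _ avoids_in_path_algebra[OF A] hit, symmetric]) simp
    also have "\<dots> \<le> measure (P x) ({\<omega> \<in> space (P x). X x \<omega> \<in> avoids A (k / 2 ^ n)}
        - {\<omega> \<in> space (P x). X x \<omega> \<in> avoids A (real (k + m) / 2 ^ n)})"
    proof (rule x.finite_measure_mono)
      \<comment> \<open>By contraposition: if the shifted path hits \<open>A\<close> within time
        \<open>M\<close>, then the path itself does not avoid \<open>A\<close> up to the grid point
        with index \<open>k + m\<close>.\<close>
      have "shift_path (k / 2 ^ n) p \<in> avoids A M" if p: "p \<in> avoids A (real (k + m) / 2 ^ n)" for p
        unfolding avoids_def
      proof (intro CollectI ballI impI)
        fix r :: real assume r: "r \<in> \<rat>" "0 \<le> r \<and> r \<le> M"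
        then have "r + k / 2 ^ n \<in> \<rat>" by (intro Rats_add grid_point_rational)
        moreover have "0 \<le> r + k / 2 ^ n" "r + k / 2 ^ n \<le> M + k / 2 ^ n" using r by auto
        ultimately show "shift_path (k / 2 ^ n) p r \<notin> Some ` A"
          using p unfolding t by (simp only: avoids_def shift_path_def) blast
      qed
      then show "{\<omega> \<in> space (P x). X x \<omega> \<in> avoids A (k / 2 ^ n)
          \<and> X x \<omega> (k / 2 ^ n) = Some y \<and> shift_path (k / 2 ^ n) (X x \<omega>) \<in> - avoids A M}
        \<subseteq> {\<omega> \<in> space (P x). X x \<omega> \<in> avoids A (k / 2 ^ n)}
          - {\<omega> \<in> space (P x). X x \<omega> \<in> avoids A (real (k + m) / 2 ^ n)}"
        by auto
    qed (intro sets.Diff ev)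
    also have "\<dots> = b k - b (k + m)"
      unfolding b_def
    proof (rule x.finite_measure_Diff[OF ev ev])
      have "avoids A (real (k + m) / 2 ^ n) \<subseteq> avoids A (k / 2 ^ n)"
        by (intro avoids_antimono divide_right_mono) auto
      then show "{\<omega> \<in> space (P x). X x \<omega> \<in> avoids A (real (k + m) / 2 ^ n)}
          \<subseteq> {\<omega> \<in> space (P x). X x \<omega> \<in> avoids A (k / 2 ^ n)}" by auto
    qed
    finally show ?thesis .
  qed
  have "(\<Sum>k<N. a k) / 2 \<le> (\<Sum>k<N. b k - b (k + m))"
    unfolding sum_divide_distrib by (intro sum_mono step)
  also have "\<dots> \<le> m"
    by (rule sum_shifted_difference_le) (auto simp: b_def)
  finally show ?thesis by (simp add: a_def m_def)
qed

text \<open>By the Markov property at \<open>k / 2 ^ n\<close>, the \<open>k\<close>-th grid visit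
  has probability \<open>a k * r\<close>. The occupation sum grows like \<open>2 ^ n\<close> while
  \<open>r\<close> is at most \<open>w y / 2 ^ n\<close>, so the mesh cancels.\<close>

lemma grid_count_expectation_le:
  fixes M :: nat
  assumes A: "finite A"
    and M: "measure (P y) {\<omega> \<in> space (P y). X y \<omega> \<in> avoids A M} \<le> 1 / 2"
  shows "(\<integral>\<^sup>+\<omega>. grid_count A y n (X x \<omega>) \<partial>P x) \<le> ennreal (2 * M * w y)"
proof -
  interpret x: prob_space "P x" by (rule prob_space)
  define a where "a k = measure (P x)
    {\<omega> \<in> space (P x). X x \<omega> \<in> avoids A (k / 2 ^ n) \<and> X x \<omega> (k / 2 ^ n) = Some y}" for k :: nat
  define r where "r = measure (P y) {\<omega> \<in> space (P y). X y \<omega> \<in> - stays y 0 (1 / 2 ^ n)}"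
  have leave: "- stays y 0 (1 / 2 ^ n) \<in> sets (path_algebra {0..})"
    by (intro Compl_in_path_algebra stays_in_path_algebra) auto
  have r: "0 \<le> r" "r \<le> w y / 2 ^ n"
    using prob_not_stays_le[of "1 / 2 ^ n" y] by (auto simp: r_def)
  have visit: "measure (P x) {\<omega> \<in> space (P x). X x \<omega> \<in> grid_visit A y n k} = a k * r" for k
  proof -
    have "p \<in> grid_visit A y n k \<longleftrightarrow> p \<in> avoids A (k / 2 ^ n) \<and> p (k / 2 ^ n) = Some y
        \<and> shift_path (k / 2 ^ n) p \<in> - stays y 0 (1 / 2 ^ n)" for p
      by (auto simp: grid_visit_def stays_shift_iff add_divide_distrib add.commute)
    then show ?thesis
      unfolding a_def r_def
      by (subst markov[OF _ avoids_in_path_algebra[OF A] leave, symmetric]) simp_all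
  qed
  have [measurable]: "(\<lambda>\<omega>. indicator (grid_visit A y n k) (X x \<omega>)) \<in> borel_measurable (P x)" for k
    by (intro measurable_compose[OF measurable] borel_measurable_indicator
        grid_visit_in_path_algebra A)
  have "(\<integral>\<^sup>+\<omega>. grid_count A y n (X x \<omega>) \<partial>P x)
      = (\<Sum>k. \<integral>\<^sup>+\<omega>. indicator (grid_visit A y n k) (X x \<omega>) \<partial>P x)"
    unfolding grid_count_def by (rule nn_integral_suminf) measurable
  also have "\<dots> = (\<Sum>k. ennreal (a k * r))"
  proof (rule suminf_cong)
    fix k
    have "(\<integral>\<^sup>+\<omega>. indicator (grid_visit A y n k) (X x \<omega>) \<partial>P x)
        = (\<integral>\<^sup>+\<omega>. indicator {\<omega> \<in> space (P x). X x \<omega> \<in> grid_visit A y n k} \<omega> \<partial>P x)"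
      by (intro nn_integral_cong) (simp add: indicator_def)
    also have "\<dots> = emeasure (P x) {\<omega> \<in> space (P x). X x \<omega> \<in> grid_visit A y n k}"
      by (intro nn_integral_indicator path_event grid_visit_in_path_algebra A)
    finally show "(\<integral>\<^sup>+\<omega>. indicator (grid_visit A y n k) (X x \<omega>) \<partial>P x) = ennreal (a k * r)"
      by (simp add: x.emeasure_eq_measure visit)
  qed
  also have "\<dots> \<le> ennreal (2 * M * w y)"
  proof (rule suminf_le_const)
    fix N
    have "(\<Sum>k<N. a k * r) \<le> 2 * (M * 2 ^ n) * (w y / 2 ^ n)"
      unfolding sum_distrib_right[symmetric]
      using grid_occupation_le[OF A M, where x = x and n = n and N = N] r
      by (intro mult_mono) (auto simp: a_def)
    also have "\<dots> = 2 * M * w y" by simp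
    finally show "(\<Sum>k<N. ennreal (a k * r)) \<le> ennreal (2 * M * w y)"
      using r(1) by (subst sum_ennreal) (auto simp: a_def intro: ennreal_leI)
  qed simp
  finally show ?thesis .
qed

text \<open>The bound on the expected grid counts does not depend on \<open>n\<close>, so it
  survives the \<open>liminf\<close>.\<close>

lemma green_finite:
  assumes A: "finite A" "A \<noteq> {}"
  shows "green P X A x y < \<infinity>"
proof -
  obtain M :: nat where M: "measure (P y) {\<omega> \<in> space (P y). X y \<omega> \<in> avoids A M} \<le> 1 / 2"
    using exists_half_hitting_time[OF A] by blast
  have "green P X A x y \<le> liminf (\<lambda>n. \<integral>\<^sup>+\<omega>. grid_count A y n (X x \<omega>) \<partial>P x)"
    unfolding green_eq_visit_count[OF A] visit_count_def
    by (intro nn_integral_liminf measurable_compose[OF measurable] borel_measurable_grid_count A)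
  also have "\<dots> \<le> ennreal (2 * M * w y)"
    by (intro Liminf_le always_eventually allI grid_count_expectation_le A M) simp
  also have "\<dots> < \<infinity>" by simp
  finally show ?thesis .
qed

end

section \<open>The first-step equation\<close>

text \<open>Dominated convergence for indicators. It is applied to grid approximations that agree
  with the limit event once the grid is fine enough for the given path.\<close>

lemma (in finite_measure) measure_tendsto_AE:
  assumes S: "\<And>n. S n \<in> sets M" and L: "L \<in> sets M"
    and AE: "AE \<omega> in M. \<forall>\<^sub>F n in sequentially. \<omega> \<in> S n \<longleftrightarrow> \<omega> \<in> L"
  shows "(\<lambda>n. measure M (S n)) \<longlonglongrightarrow> measure M L"
proof -
  have "(\<lambda>n. \<integral>\<omega>. indicat_real (S n) \<omega> \<partial>M) \<longlonglongrightarrow> (\<integral>\<omega>. indicat_real L \<omega> \<partial>M)"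
  proof (rule integral_dominated_convergence[where w = "\<lambda>_. 1"])
    show "AE \<omega> in M. (\<lambda>n. indicat_real (S n) \<omega>) \<longlonglongrightarrow> indicat_real L \<omega>"
      using AE
    proof eventually_elim
      case (elim \<omega>)
      then have "\<forall>\<^sub>F n in sequentially. indicat_real (S n) \<omega> = indicat_real L \<omega>"
        by eventually_elim (simp add: indicator_def)
      then show ?case by (rule tendsto_eventually)
    qed
  qed (use S L in \<open>auto simp: indicator_def\<close>)
  then show ?thesis using S L by simp
qed

text \<open>Links integrals over \<open>count_space\<close>, for which Tonelli is available, with
  the \<open>infsum\<close> in which conductances are summed.\<close>

lemma nn_integral_count_space_eq_infsum:
  fixes f :: "'a \<Rightarrow> real"
  assumes "f summable_on N" "\<And>z. z \<in> N \<Longrightarrow> 0 \<le> f z"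
  shows "(\<integral>\<^sup>+z. ennreal (f z) \<partial>count_space N) = ennreal (infsum f N)"
proof -
  have "Infinite_Set_Sum.abs_summable_on f N"
    using assms(1) unfolding abs_summable_equivalent[symmetric]
    by (rule summable_on_iff_abs_summable_on_real[THEN iffD1])
  then show ?thesis using assms(2) by (simp add: nn_integral_conv_infsetsum infsetsum_infsum)
qed

context reflected_walk
begin

section \<open>The exit from the starting vertex\<close>

lemma AE_exit:
  "AE \<omega> in P x. 0 < exit_time x (X x \<omega>)
    \<and> (\<forall>s. 0 \<le> s \<and> s < exit_time x (X x \<omega>) \<longrightarrow> X x \<omega> s = Some x)
    \<and> X x \<omega> (exit_time x (X x \<omega>)) \<noteq> Some x"
  using start exit_attained
proof eventually_elim
  case (elim \<omega>)
  note exit = has_minimum_Least[OF elim(2), folded exit_time_def]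
  \<comment> \<open>The exit time looks at positive times only, so time 0 has to come from
    \<open>start\<close>.\<close>
  have "X x \<omega> s = Some x" if "0 \<le> s" "s < exit_time x (X x \<omega>)" for s
    using that elim(1) exit(2)[of s] by (cases "s = 0") force+
  then show ?case using exit(1) by simp
qed

definition exits_to :: "'v \<Rightarrow> 'v \<Rightarrow> 'w set"
  where "exits_to x z = {\<omega> \<in> space (P x). X x \<omega> (exit_time x (X x \<omega>)) = Some z}"

lemma measure_exits_to:
  "z \<in> neighbours E x \<Longrightarrow> measure (P x) (exits_to x z) = c {x, z} / total_conductance E c x"
  unfolding exits_to_def by (rule exit_position)

text \<open>A set outside the sigma-algebra has measure \<open>0\<close>, but the exit probability is positive.\<close>

lemma exits_to_measurable:
  assumes "z \<in> neighbours E x" "0 < total_conductance E c x"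
  shows "exits_to x z \<in> sets (P x)"
proof (rule ccontr)
  assume "exits_to x z \<notin> sets (P x)"
  then have "c {x, z} / total_conductance E c x = 0"
    using measure_exits_to[OF assms(1)] by (simp add: measure_notin_sets)
  moreover have "0 < c {x, z}" using assms(1) conductance_pos by (simp add: neighbours_def)
  ultimately show False using assms(2) by simp
qed

text \<open>The probabilities of the individual neighbours sum to 1, which leaves probability 0 for
  infinity and for all other vertices.\<close>

lemma AE_exits_to_neighbour:
  assumes count: "countable (UNIV :: 'v set)"
    and summable: "(\<lambda>y. c {x, y}) summable_on neighbours E x"
    and pos: "0 < total_conductance E c x"
  shows "AE \<omega> in P x. \<exists>z\<in>neighbours E x. X x \<omega> (exit_time x (X x \<omega>)) = Some z"
proof -
  interpret prob_space "P x" by (rule prob_space)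
  let ?N = "neighbours E x"
  have N: "countable ?N" using subset_UNIV count by (rule countable_subset)
  have c: "0 < c {x, z}" if "z \<in> ?N" for z using that conductance_pos by (simp add: neighbours_def)
  have meas: "exits_to x z \<in> sets (P x)" if "z \<in> ?N" for z
    using exits_to_measurable[OF that pos] .
  have "emeasure (P x) (\<Union>z\<in>?N. exits_to x z)
      = (\<integral>\<^sup>+z. emeasure (P x) (exits_to x z) \<partial>count_space ?N)"
    using N meas by (intro emeasure_UN_countable) (auto simp: disjoint_family_on_def exits_to_def)
  also have "\<dots> = (\<integral>\<^sup>+z. ennreal (c {x, z} / total_conductance E c x) \<partial>count_space ?N)"
    by (intro nn_integral_cong) (simp add: emeasure_eq_measure measure_exits_to)
  also have "\<dots> = ennreal (\<Sum>\<^sub>\<infinity>z\<in>?N. c {x, z} / total_conductance E c x)"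
    using c pos summable_on_cmult_left[OF summable, of "inverse (total_conductance E c x)"]
    by (intro nn_integral_count_space_eq_infsum) (auto simp: divide_inverse intro: less_imp_le)
  also have "(\<Sum>\<^sub>\<infinity>z\<in>?N. c {x, z} / total_conductance E c x) = 1"
    using pos unfolding divide_inverse by (simp add: infsum_cmult_left' flip: total_conductance_def)
  finally have "prob (\<Union>z\<in>?N. exits_to x z) = 1" by (simp add: emeasure_eq_measure)
  then have "AE \<omega> in P x. \<omega> \<in> (\<Union>z\<in>?N. exits_to x z)" by (rule AE_prob_1)
  then show ?thesis by eventually_elim (auto simp: exits_to_def)
qed

text \<open>The exit time is approximated from above by the next point of the \<open>n\<close>-th grid, to which the
  Markov property at deterministic times applies.\<close>

definition grid_exit :: "'v \<Rightarrow> 'v \<Rightarrow> nat \<Rightarrow> (real \<Rightarrow> 'v option) set \<Rightarrow> nat \<Rightarrow> 'w set"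
  where "grid_exit x z n C k = {\<omega> \<in> space (P x).
    X x \<omega> \<in> stays x 0 (k / 2 ^ n) - stays x 0 (Suc k / 2 ^ n) \<and>
    X x \<omega> (Suc k / 2 ^ n) = Some z \<and> shift_path (Suc k / 2 ^ n) (X x \<omega>) \<in> C}"

lemma grid_exit_measurable:
  assumes "C \<in> sets (path_algebra {0..})"
  shows "grid_exit x z n C k \<in> sets (P x)"
proof -
  have "grid_exit x z n C k = {\<omega> \<in> space (P x). X x \<omega> \<in>
      (stays x 0 (k / 2 ^ n) - stays x 0 (Suc k / 2 ^ n)) \<inter>
      {p. p (Suc k / 2 ^ n) = Some z} \<inter> (shift_path (Suc k / 2 ^ n) -` C \<inter> space (path_algebra {0..}))}"
    by (auto simp: grid_exit_def)
  also have "\<dots> \<in> sets (P x)"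
    by (intro path_event sets.Int sets.Diff stays_in_path_algebra coordinate_in_path_algebra
        measurable_sets[OF measurable_shift_path] assms) auto
  finally show ?thesis .
qed

text \<open>The Markov property at each time \<open>Suc k / 2 ^ n\<close> splits off the same
  factor, so it can be pulled out of the sum over the disjoint events. The case of
  \<open>UNIV\<close> identifies the remaining factor.\<close>

lemma measure_Union_grid_exit:
  assumes C: "C \<in> sets (path_algebra {0..})"
  shows "measure (P x) (\<Union>k. grid_exit x z n C k)
    = measure (P x) (\<Union>k. grid_exit x z n UNIV k) * measure (P z) {\<omega> \<in> space (P z). X z \<omega> \<in> C}"
proof -
  interpret x: prob_space "P x" by (rule prob_space)
  interpret z: prob_space "P z" by (rule prob_space)
  have disj: "disjoint_family (grid_exit x z n D)" for D
  proof -
    \<comment> \<open>Staying at \<open>x\<close> up to the later grid point contradicts having left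
      in the earlier cell.\<close>
    have "grid_exit x z n D k \<inter> grid_exit x z n D k' = {}" if "k < k'" for k k'
    proof -
      have "Suc k / 2 ^ n \<le> k' / (2::real) ^ n" using that by (intro divide_right_mono) auto
      then have "stays x 0 (k' / 2 ^ n) \<subseteq> stays x 0 (Suc k / 2 ^ n)" by (auto simp: stays_def)
      then show ?thesis by (auto simp: grid_exit_def)
    qed
    then show ?thesis
      unfolding disjoint_family_on_def by (metis Int_commute nat_neq_iff)
  qed
  have sums: "(\<lambda>k. measure (P x) (grid_exit x z n D k)) sums measure (P x) (\<Union>k. grid_exit x z n D k)"
    if "D \<in> sets (path_algebra {0..})" for D
    using grid_exit_measurable[OF that] disj by (intro x.finite_measure_UNION) auto
  have factor: "measure (P x) (grid_exit x z n D k)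
      = measure (P x) {\<omega> \<in> space (P x). X x \<omega> \<in> stays x 0 (k / 2 ^ n) - stays x 0 (Suc k / 2 ^ n)
          \<and> X x \<omega> (Suc k / 2 ^ n) = Some z}
        * measure (P z) {\<omega> \<in> space (P z). X z \<omega> \<in> D}"
    if "D \<in> sets (path_algebra {0..})" for D k
    unfolding grid_exit_def
  proof (rule markov[OF _ _ that])
    have "k / 2 ^ n \<le> Suc k / (2::real) ^ n" by (intro divide_right_mono) auto
    then show "stays x 0 (k / 2 ^ n) - stays x 0 (Suc k / 2 ^ n)
        \<in> sets (path_algebra {0..Suc k / 2 ^ n})"
      by (intro sets.Diff stays_in_path_algebra) auto
  qed simp
  have U: "UNIV \<in> sets (path_algebra {0..})" by (metis sets.top space_path_algebra)
  have "measure (P x) (grid_exit x z n C k) = measure (P x) (grid_exit x z n UNIV k)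
      * measure (P z) {\<omega> \<in> space (P z). X z \<omega> \<in> C}" for k
    using factor[OF C, of k] factor[OF U, of k] by (simp add: z.prob_space)
  then have "(\<lambda>k. measure (P x) (grid_exit x z n C k)) sums (measure (P x) (\<Union>k. grid_exit x z n UNIV k)
      * measure (P z) {\<omega> \<in> space (P z). X z \<omega> \<in> C})"
    using sums_mult2[OF sums[OF U]] by simp
  with sums[OF C] show ?thesis by (rule sums_unique2)
qed

text \<open>On a fine enough grid the walk still sits at the vertex it jumped to when the first grid
  point after the exit arrives, so exit vertex and remaining visits can be read off there. The index
  \<open>k\<close> depends on the path and on \<open>n\<close>, but not on \<open>z\<close> and
  \<open>C\<close>.\<close>

lemma AE_visit_count_after_exit:
  assumes count: "countable (UNIV :: 'v set)"
    and summable: "(\<lambda>y. c {x, y}) summable_on neighbours E x"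
    and pos: "0 < total_conductance E c x" and x: "x \<notin> A"
  shows "AE \<omega> in P x. \<forall>\<^sub>F n in sequentially. \<exists>k.
    (\<forall>z C. \<omega> \<in> (\<Union>k. grid_exit x z n C k) \<longleftrightarrow>
      \<omega> \<in> exits_to x z \<and> shift_path (Suc k / 2 ^ n) (X x \<omega>) \<in> C) \<and>
    visit_count A y (X x \<omega>)
      = (if x = y then 1 else 0) + visit_count A y (shift_path (Suc k / 2 ^ n) (X x \<omega>))"
  using AE_exit AE_exits_to_neighbour[OF count summable pos] AE_right_constant_path AE_space
proof eventually_elim
  case (elim \<omega>)
  let ?p = "X x \<omega>"
  define \<tau> where "\<tau> = exit_time x ?p"
  obtain z0 where z0: "?p \<tau> = Some z0" using elim(2) by (auto simp: \<tau>_def)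
  have \<tau>: "0 < \<tau>" "\<And>s. 0 \<le> s \<Longrightarrow> s < \<tau> \<Longrightarrow> ?p s = Some x" "x \<noteq> z0"
    using elim(1) z0 by (auto simp: \<tau>_def)
  obtain \<epsilon> where \<epsilon>: "0 < \<epsilon>" "\<And>s. \<tau> \<le> s \<Longrightarrow> s \<le> \<tau> + \<epsilon> \<Longrightarrow> ?p s = Some z0"
    using right_constant_pathE[OF elim(3) _ z0] \<tau>(1) by auto
  show ?case
    using eventually_inverse_power2_le[OF \<epsilon>(1)]
  proof eventually_elim
    case n: (elim n)
    \<comment> \<open>The cell from \<open>k / 2 ^ n\<close>, exclusive, to
      \<open>Suc k / 2 ^ n\<close>, inclusive, contains the exit time.\<close>
    define k where "k = nat (\<lceil>\<tau> * 2 ^ n\<rceil> - 1)"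
    have "1 \<le> \<lceil>\<tau> * 2 ^ n\<rceil>" using \<tau>(1) by (simp add: ceiling_le_iff)
    then have "k < \<tau> * 2 ^ n" "\<tau> * 2 ^ n \<le> Suc k" unfolding k_def by linarith+
    then have k: "k / 2 ^ n < \<tau>" "\<tau> \<le> Suc k / 2 ^ n" by (simp_all add: field_simps)
    have "Suc k / 2 ^ n \<le> \<tau> + \<epsilon>" using k(1) n by (simp add: add_divide_distrib)
    then have after: "?p s = Some z0" if "\<tau> \<le> s" "s \<le> Suc k / 2 ^ n" for s
      using that by (intro \<epsilon>(2)) auto
    have stays: "?p \<in> stays x 0 (i / 2 ^ n) \<longleftrightarrow> i / 2 ^ n < \<tau>" for i :: nat
    proof
      assume "?p \<in> stays x 0 (i / 2 ^ n)"
      then have "\<tau> \<in> {0..i / 2 ^ n} \<Longrightarrow> ?p \<tau> = Some x" by (simp add: stays_def)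
      then show "i / 2 ^ n < \<tau>" using z0 \<tau>(1,3) by (cases "i / 2 ^ n < \<tau>") auto
    next
      assume "i / 2 ^ n < \<tau>"
      then show "?p \<in> stays x 0 (i / 2 ^ n)" unfolding stays_def using \<tau>(2) by auto
    qed
    \<comment> \<open>Hence only the term with this \<open>k\<close> can contribute to the union
      over all cells.\<close>
    have unique: "?p \<in> stays x 0 (i / 2 ^ n) - stays x 0 (Suc i / 2 ^ n) \<longleftrightarrow> i = k" for i
    proof
      assume "?p \<in> stays x 0 (i / 2 ^ n) - stays x 0 (Suc i / 2 ^ n)"
      then have "i / 2 ^ n < \<tau>" "\<tau> \<le> Suc i / 2 ^ n" unfolding Diff_iff stays by auto
      with k have "i / 2 ^ n < Suc k / (2::real) ^ n" "k / 2 ^ n < Suc i / (2::real) ^ n" by linarith+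
      then show "i = k" by (simp add: divide_less_cancel)
    next
      assume "i = k"
      then show "?p \<in> stays x 0 (i / 2 ^ n) - stays x 0 (Suc i / 2 ^ n)"
        unfolding Diff_iff stays using k by auto
    qed
    have "visit_count A y ?p
        = (if x = y then 1 else 0) + visit_count A y (shift_path (Suc k / 2 ^ n) ?p)"
      by (rule visit_count_shift[OF x \<tau>(3) \<tau>(2) after refl \<tau>(1) k(2)])
    moreover have "\<omega> \<in> (\<Union>k. grid_exit x z n C k) \<longleftrightarrow>
        \<omega> \<in> exits_to x z \<and> shift_path (Suc k / 2 ^ n) ?p \<in> C" for z C
    proof -
      have "\<omega> \<in> (\<Union>k. grid_exit x z n C k) \<longleftrightarrow> \<omega> \<in> grid_exit x z n C k"
        unfolding grid_exit_def UN_iff mem_Collect_eq unique by blast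
      also have "\<dots> \<longleftrightarrow> ?p (Suc k / 2 ^ n) = Some z \<and> shift_path (Suc k / 2 ^ n) ?p \<in> C"
        unfolding grid_exit_def mem_Collect_eq unique using elim(4) by simp
      also have "?p (Suc k / 2 ^ n) = Some z \<longleftrightarrow> \<omega> \<in> exits_to x z"
        using after[OF k(2)] z0 elim(4) by (simp add: exits_to_def \<tau>_def)
      finally show ?thesis .
    qed
    ultimately show ?case by blast
  qed
qed

text \<open>The strong Markov property at the exit time, for the visit count only, obtained from the
  grid version as the mesh tends to 0. The subtracted term is the initial visit, present if the walk
  starts at \<open>y\<close>.\<close>

lemma measure_exit_and_visit_count:
  assumes count: "countable (UNIV :: 'v set)"
    and summable: "(\<lambda>y. c {x, y}) summable_on neighbours E x"
    and pos: "0 < total_conductance E c x" and x: "x \<notin> A" and A: "finite A"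
    and z: "z \<in> neighbours E x" and B: "B \<in> sets borel"
  shows "measure (P x) {\<omega> \<in> exits_to x z. visit_count A y (X x \<omega>) - (if x = y then 1 else 0) \<in> B}
    = measure (P x) (exits_to x z) * measure (P z) {\<omega> \<in> space (P z). visit_count A y (X z \<omega>) \<in> B}"
proof -
  interpret prob_space "P x" by (rule prob_space)
  let ?\<delta> = "if x = y then 1 else 0 :: ennreal"
  let ?L = "\<lambda>B. {\<omega> \<in> exits_to x z. visit_count A y (X x \<omega>) - ?\<delta> \<in> B}"
  let ?C = "\<lambda>B. visit_count A y -` B"
  have exit [measurable]: "exits_to x z \<in> sets (P x)"
    using z pos by (rule exits_to_measurable)
  have [measurable]: "(\<lambda>\<omega>. visit_count A y (X x \<omega>)) \<in> borel_measurable (P x)"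
    by (intro measurable_compose[OF measurable] borel_measurable_visit_count A)
  have C: "?C B \<in> sets (path_algebra {0..})" if "B \<in> sets borel" for B
    using measurable_sets[OF borel_measurable_visit_count[OF A] that] by simp
  have lim: "(\<lambda>n. measure (P x) (\<Union>k. grid_exit x z n (?C B) k)) \<longlonglongrightarrow> measure (P x) (?L B)"
    if B[measurable]: "B \<in> sets borel" for B
  proof (rule measure_tendsto_AE)
    show "(\<Union>k. grid_exit x z n (?C B) k) \<in> sets (P x)" for n
      using grid_exit_measurable[OF C[OF B]] by blast
    have "?L B = exits_to x z \<inter> {\<omega> \<in> space (P x). visit_count A y (X x \<omega>) - ?\<delta> \<in> B}"
      using sets.sets_into_space[OF exit] by auto
    also have "\<dots> \<in> sets (P x)" by measurable
    finally show "?L B \<in> sets (P x)" .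
    show "AE \<omega> in P x. \<forall>\<^sub>F n in sequentially.
        \<omega> \<in> (\<Union>k. grid_exit x z n (?C B) k) \<longleftrightarrow> \<omega> \<in> ?L B"
      using AE_visit_count_after_exit[OF count summable pos x, of y]
    proof eventually_elim
      case (elim \<omega>)
      then show ?case
      proof eventually_elim
        case (elim n)
        then obtain k where k: "\<And>z C. \<omega> \<in> (\<Union>k. grid_exit x z n C k) \<longleftrightarrow>
            \<omega> \<in> exits_to x z \<and> shift_path (Suc k / 2 ^ n) (X x \<omega>) \<in> C"
          "visit_count A y (X x \<omega>) = ?\<delta> + visit_count A y (shift_path (Suc k / 2 ^ n) (X x \<omega>))"
          by blast
        \<comment> \<open>Subtraction in \<open>ennreal\<close> is truncated; it undoes the addition
          here because the first summand is finite.\<close>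
        from k(2) have "visit_count A y (X x \<omega>) - ?\<delta>
            = visit_count A y (shift_path (Suc k / 2 ^ n) (X x \<omega>))"
          by (simp add: ennreal_add_diff_cancel_left)
        then show ?case unfolding k(1) by simp
      qed
    qed
  qed
  \<comment> \<open>The same limit with \<open>UNIV\<close> in place of \<open>B\<close> yields the
    exit probability as first factor.\<close>
  have "(\<lambda>n. measure (P x) (\<Union>k. grid_exit x z n (?C UNIV) k)
      * measure (P z) {\<omega> \<in> space (P z). X z \<omega> \<in> ?C B})
    \<longlonglongrightarrow> measure (P x) (?L UNIV) * measure (P z) {\<omega> \<in> space (P z). X z \<omega> \<in> ?C B}"
    by (intro tendsto_mult_right lim) simp
  moreover have "(\<lambda>n. measure (P x) (\<Union>k. grid_exit x z n (?C UNIV) k)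
      * measure (P z) {\<omega> \<in> space (P z). X z \<omega> \<in> ?C B}) \<longlonglongrightarrow> measure (P x) (?L B)"
    using lim[OF B] measure_Union_grid_exit[OF C[OF B]] by simp
  ultimately have "measure (P x) (?L B)
      = measure (P x) (?L UNIV) * measure (P z) {\<omega> \<in> space (P z). X z \<omega> \<in> ?C B}"
    by (rule LIMSEQ_unique[rotated])
  then show ?thesis by simp
qed

text \<open>The previous factorisation says that two measures on \<open>ennreal\<close> agree: the
  law of the remaining count restricted to the exit event, and the scaled law of the count started
  at \<open>z\<close>. Integrating the identity gives the claim.\<close>

lemma nn_integral_exit_and_visit_count:
  assumes count: "countable (UNIV :: 'v set)"
    and summable: "(\<lambda>y. c {x, y}) summable_on neighbours E x"
    and pos: "0 < total_conductance E c x" and x: "x \<notin> A" and A: "finite A" "A \<noteq> {}"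
    and z: "z \<in> neighbours E x"
  shows "(\<integral>\<^sup>+\<omega>. indicator (exits_to x z) \<omega> * (visit_count A y (X x \<omega>) - (if x = y then 1 else 0)) \<partial>P x)
    = ennreal (c {x, z} / total_conductance E c x) * green P X A z y"
proof -
  interpret x: prob_space "P x" by (rule prob_space)
  interpret z: prob_space "P z" by (rule prob_space)
  let ?\<delta> = "if x = y then 1 else 0 :: ennreal"
  let ?f = "\<lambda>\<omega>. visit_count A y (X x \<omega>) - ?\<delta>" and ?g = "\<lambda>\<omega>. visit_count A y (X z \<omega>)"
  let ?M = "distr (density (P x) (indicator (exits_to x z))) borel ?f"
  let ?N = "scale_measure (measure (P x) (exits_to x z)) (distr (P z) borel ?g)"
  have exit [measurable]: "exits_to x z \<in> sets (P x)"
    using z pos by (rule exits_to_measurable)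
  have [measurable]: "(\<lambda>\<omega>. visit_count A y (X v \<omega>)) \<in> borel_measurable (P v)" for v
    by (intro measurable_compose[OF measurable] borel_measurable_visit_count A)
  have "?M = ?N"
  proof (rule measure_eqI)
    fix B assume "B \<in> sets ?M"
    then have B [measurable]: "B \<in> sets borel" by simp
    have "emeasure ?M B = emeasure (density (P x) (indicator (exits_to x z))) (?f -` B \<inter> space (P x))"
      by (subst emeasure_distr) (auto simp: space_density)
    also have "\<dots> = emeasure (P x) (exits_to x z \<inter> (?f -` B \<inter> space (P x)))"
      by (intro emeasure_restricted) measurable
    also have "exits_to x z \<inter> (?f -` B \<inter> space (P x)) = {\<omega> \<in> exits_to x z. ?f \<omega> \<in> B}"
      using sets.sets_into_space[OF exit] by auto
    also have "emeasure (P x) \<dots> = ennreal (measure (P x) (exits_to x z)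
        * measure (P z) {\<omega> \<in> space (P z). ?g \<omega> \<in> B})"
      using measure_exit_and_visit_count[OF count summable pos x A(1) z B]
      by (simp add: x.emeasure_eq_measure)
    also have "\<dots> = measure (P x) (exits_to x z) * emeasure (P z) (?g -` B \<inter> space (P z))"
      by (simp add: z.emeasure_eq_measure ennreal_mult vimage_def Int_def conj_commute)
    also have "\<dots> = emeasure ?N B" by (simp add: emeasure_distr)
    finally show "emeasure ?M B = emeasure ?N B" .
  qed simp
  then have "(\<integral>\<^sup>+v. v \<partial>?M) = (\<integral>\<^sup>+v. v \<partial>?N)" by simp
  then show ?thesis
    by (simp add: nn_integral_distr nn_integral_density nn_integral_scale_measure
        green_eq_visit_count[OF A] measure_exits_to[OF z])
qed

lemma green_first_step:
  assumes count: "countable (UNIV :: 'v set)"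
    and summable: "(\<lambda>y. c {x, y}) summable_on neighbours E x"
    and pos: "0 < total_conductance E c x" and x: "x \<notin> A" and A: "finite A" "A \<noteq> {}"
  shows "green P X A x y = (if x = y then 1 else 0)
    + (\<integral>\<^sup>+z. ennreal (c {x, z} / total_conductance E c x) * green P X A z y \<partial>count_space (neighbours E x))"
proof -
  interpret prob_space "P x" by (rule prob_space)
  let ?N = "neighbours E x"
  let ?\<delta> = "if x = y then 1 else 0 :: ennreal"
  let ?f = "\<lambda>\<omega>. visit_count A y (X x \<omega>) - ?\<delta>"
  have exit [measurable]: "exits_to x z \<in> sets (P x)" if "z \<in> ?N" for z
    using that pos by (rule exits_to_measurable)
  have [measurable]: "(\<lambda>\<omega>. visit_count A y (X x \<omega>)) \<in> borel_measurable (P x)"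
    by (intro measurable_compose[OF measurable] borel_measurable_visit_count A)
  have "green P X A x y = (\<integral>\<^sup>+\<omega>. ?\<delta> + ?f \<omega> \<partial>P x)"
    unfolding green_eq_visit_count[OF A]
  proof (rule nn_integral_cong_AE)
    show "AE \<omega> in P x. visit_count A y (X x \<omega>) = ?\<delta> + ?f \<omega>"
      using AE_visit_count_after_exit[OF count summable pos x, of y]
    proof eventually_elim
      case (elim \<omega>)
      \<comment> \<open>Any single fine enough grid supplies this decomposition, so adding back the
        subtracted term is legitimate.\<close>
      then obtain v where "visit_count A y (X x \<omega>) = ?\<delta> + v"
        using eventually_happens[OF elim] by auto
      then show ?case by (simp add: ennreal_add_diff_cancel_left)
    qed
  qed
  also have "\<dots> = ?\<delta> + (\<integral>\<^sup>+\<omega>. ?f \<omega> \<partial>P x)"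
    by (subst nn_integral_add) (auto simp: emeasure_space_1)
  also have "(\<integral>\<^sup>+\<omega>. ?f \<omega> \<partial>P x)
      = (\<integral>\<^sup>+\<omega>. \<integral>\<^sup>+z. indicator (exits_to x z) \<omega> * ?f \<omega> \<partial>count_space ?N \<partial>P x)"
  proof (rule nn_integral_cong_AE)
    show "AE \<omega> in P x. ?f \<omega> = (\<integral>\<^sup>+z. indicator (exits_to x z) \<omega> * ?f \<omega> \<partial>count_space ?N)"
      using AE_exits_to_neighbour[OF count summable pos] AE_space
    proof eventually_elim
      case (elim \<omega>)
      then obtain z0 where z0: "z0 \<in> ?N" "X x \<omega> (exit_time x (X x \<omega>)) = Some z0" by blast
      \<comment> \<open>Only the actual exit vertex contributes to the sum.\<close>
      have "(\<integral>\<^sup>+z. indicator (exits_to x z) \<omega> * ?f \<omega> \<partial>count_space ?N)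
          = (\<integral>\<^sup>+z. ?f \<omega> * indicator {z0} z \<partial>count_space ?N)"
        using z0(2) elim(2) by (intro nn_integral_cong) (auto simp: exits_to_def indicator_def)
      also have "\<dots> = ?f \<omega>" using z0(1) by (subst nn_integral_cmult_indicator) auto
      finally show ?case by simp
    qed
  qed
  also have "\<dots> = (\<integral>\<^sup>+z. \<integral>\<^sup>+\<omega>. indicator (exits_to x z) \<omega> * ?f \<omega> \<partial>P x \<partial>count_space ?N)"
    using countable_subset[OF subset_UNIV count]
    by (intro nn_integral_count_space_nn_integral) measurable
  also have "\<dots> = (\<integral>\<^sup>+z. ennreal (c {x, z} / total_conductance E c x) * green P X A z y \<partial>count_space ?N)"
    by (intro nn_integral_cong nn_integral_exit_and_visit_count[OF count summable pos x A]) simp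
  finally show ?thesis .
qed

text \<open>The first-step equation multiplied by \<open>total_conductance E c x\<close>. Finiteness
  of the Green's function allows the passage from \<open>ennreal\<close> to real sums, and the two
  cases of the value give harmonicity and the equation at \<open>y\<close>.\<close>

lemma green_laplacian:
  assumes count: "countable (UNIV :: 'v set)"
    and summable: "(\<lambda>y. c {x, y}) summable_on neighbours E x"
    and pos: "0 < total_conductance E c x" and x: "x \<notin> A" and A: "finite A" "A \<noteq> {}"
  shows "((\<lambda>z. c {x, z} * (enn2real (green P X A z y) - enn2real (green P X A x y)))
    has_sum (if x = y then - total_conductance E c x else 0)) (neighbours E x)"
proof -
  let ?N = "neighbours E x" and ?\<pi> = "total_conductance E c x"
  define g where "g z = enn2real (green P X A z y)" for z
  have g: "green P X A z y = ennreal (g z)" "0 \<le> g z" for z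
    using green_finite[OF A, of z y] by (simp_all add: g_def)
  have c: "0 < c {x, z}" if "z \<in> ?N" for z using that conductance_pos by (simp add: neighbours_def)
  have "(\<integral>\<^sup>+z. ennreal (c {x, z} / ?\<pi>) * green P X A z y \<partial>count_space ?N)
      = (\<integral>\<^sup>+z. ennreal (c {x, z} / ?\<pi> * g z) \<partial>count_space ?N)"
    using c pos by (intro nn_integral_cong) (simp add: g less_imp_le flip: ennreal_mult)
  then have step: "ennreal (g x) = (if x = y then 1 else 0)
      + (\<integral>\<^sup>+z. ennreal (c {x, z} / ?\<pi> * g z) \<partial>count_space ?N)"
    using green_first_step[OF count summable pos x A, of y] by (simp add: g(1))
  \<comment> \<open>Finiteness at the single vertex \<open>x\<close> bounds the whole series over
    its neighbours, hence gives summability.\<close>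
  then have "(\<integral>\<^sup>+z. ennreal (c {x, z} / ?\<pi> * g z) \<partial>count_space ?N) \<le> ennreal (g x)"
    by (simp add: add_increasing)
  then have "(\<integral>\<^sup>+z. ennreal (c {x, z} / ?\<pi> * g z) \<partial>count_space ?N) < \<infinity>"
    by (simp add: le_less_trans)
  moreover have nonneg: "0 \<le> c {x, z} / ?\<pi> * g z" if "z \<in> ?N" for z
    using c[OF that] pos g(2) by simp
  ultimately have "Infinite_Set_Sum.abs_summable_on (\<lambda>z. c {x, z} / ?\<pi> * g z) ?N"
    unfolding Infinite_Set_Sum.abs_summable_on_def
    by (intro integrableI_nonneg) (auto simp: AE_count_space)
  then have 1: "(\<lambda>z. c {x, z} / ?\<pi> * g z) summable_on ?N"
    unfolding abs_summable_equivalent[symmetric]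
    by (rule summable_on_iff_abs_summable_on_real[THEN iffD2])
  define s where "s = (\<Sum>\<^sub>\<infinity>z\<in>?N. c {x, z} / ?\<pi> * g z)"
  have s: "0 \<le> s" unfolding s_def by (intro infsum_nonneg nonneg)
  have "ennreal (g x) = (if x = y then 1 else 0) + ennreal s"
    using step nn_integral_count_space_eq_infsum[OF 1 nonneg] by (simp add: s_def)
  also have "\<dots> = ennreal ((if x = y then 1 else 0) + s)"
    using s by (simp add: ennreal_plus)
  finally have gx: "g x = (if x = y then 1 else 0) + s" using s g(2) by (subst (asm) ennreal_inj) auto
  have "((\<lambda>z. c {x, z}) has_sum ?\<pi>) ?N"
    unfolding total_conductance_def using summable by (rule has_sum_infsum)
  moreover have "((\<lambda>z. c {x, z} / ?\<pi> * g z) has_sum s) ?N"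
    unfolding s_def using 1 by (rule has_sum_infsum)
  \<comment> \<open>The conductances sum to \<open>?\<pi>\<close>, so the constant
    \<open>g x\<close> can be subtracted inside the sum.\<close>
  ultimately have "((\<lambda>z. ?\<pi> * (c {x, z} / ?\<pi> * g z) + c {x, z} * - g x) has_sum (?\<pi> * s + ?\<pi> * - g x)) ?N"
    by (intro has_sum_add has_sum_cmult_right has_sum_cmult_left)
  moreover have "?\<pi> * s + ?\<pi> * - g x = (if x = y then - ?\<pi> else 0)"
    by (simp add: gx algebra_simps)
  ultimately show ?thesis
    using pos by (simp add: g_def[symmetric] right_diff_distrib)
qed

end

text \<open>A second vertex exists, and the first edge of a path to it gives \<open>x\<close> a
  neighbour, whose conductance is a positive lower bound. Summability matters because
  \<open>infsum\<close> of a non-summable family is 0.\<close>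

lemma total_conductance_pos:
  assumes "conductance_graph E c" "infinite (UNIV :: 'v set)" "connected_graph E"
    and summable: "(\<lambda>y. c {x, y}) summable_on neighbours E (x :: 'v)"
  shows "0 < total_conductance E c x"
proof -
  interpret conductance_graph E c by fact
  have c: "0 < c {x, z}" if "z \<in> neighbours E x" for z
    using that conductance_pos by (simp add: neighbours_def)
  obtain v where "v \<noteq> x"
    using ex_new_if_finite[OF assms(2), of "{x}"] by auto
  have "(x, v) \<in> {(u, v). v \<in> neighbours E u}\<^sup>*"
    using assms(3) by (simp add: connected_graph_def)
  then have "\<exists>z. z \<in> neighbours E x"
    using \<open>v \<noteq> x\<close> by (cases rule: converse_rtranclE) auto
  then obtain z where z: "z \<in> neighbours E x" ..
  have "(\<Sum>y\<in>{z}. c {x, y}) \<le> total_conductance E c x"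
    unfolding total_conductance_def
    using z c by (intro finite_sum_le_infsum summable) (auto intro: less_imp_le)
  with c[OF z] show ?thesis by simp
qed

theorem lemma5p6:
  fixes E :: "'v set set" and c :: "'v set \<Rightarrow> real" and w :: "'v \<Rightarrow> real"
    and P :: "'v \<Rightarrow> 'w measure" and X :: "'v \<Rightarrow> 'w \<Rightarrow> real \<Rightarrow> 'v option"
    and A :: "'v set"
  assumes "conductance_graph E c"
    and "countable (UNIV :: 'v set)" and "infinite (UNIV :: 'v set)"
    and "connected_graph E"
    and "\<forall>x. (\<lambda>y. c {x, y}) summable_on neighbours E x"
    and "reflected_walk E c w P X"
    and "finite A" and "A \<noteq> {}"
  shows "(\<forall>x y. green P X A x y < \<infinity>) \<and>
    (\<forall>y. \<forall>x. x \<notin> A \<union> {y} \<longrightarrow>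
      discrete_harmonic_at E c (\<lambda>x. enn2real (green P X A x y)) x) \<and>
    (\<forall>y. y \<notin> A \<longrightarrow>
      ((\<lambda>x. c {y, x} * (enn2real (green P X A x y) - enn2real (green P X A y y)))
        has_sum - total_conductance E c y) (neighbours E y))"
proof -
  interpret reflected_walk E c w P X by fact
  have pos: "0 < total_conductance E c x" for x
    by (rule total_conductance_pos[OF assms(1,3,4) assms(5)[rule_format]])
  have laplacian: "((\<lambda>z. c {x, z} * (enn2real (green P X A z y) - enn2real (green P X A x y)))
      has_sum (if x = y then - total_conductance E c x else 0)) (neighbours E x)"
    if "x \<notin> A" for x y
    by (rule green_laplacian[OF assms(2) assms(5)[rule_format] pos that assms(7,8)])
  have "discrete_harmonic_at E c (\<lambda>x. enn2real (green P X A x y)) x" if x: "x \<notin> A \<union> {y}" for x y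
  proof -
    let ?h = "\<lambda>z. enn2real (green P X A z y) - enn2real (green P X A x y)"
    have sum: "((\<lambda>z. c {x, z} * ?h z) has_sum 0) (neighbours E x)"
      using laplacian[of x y] x by simp
    \<comment> \<open>For real families \<open>has_sum\<close> is unconditional, so it already
      contains the absolute summability that harmonicity asks for.\<close>
    then have "(\<lambda>z. norm (c {x, z} * ?h z)) summable_on neighbours E x"
      by (intro summable_on_iff_abs_summable_on_real[THEN iffD1] has_sum_imp_summable)
    moreover have "norm (c {x, z} * ?h z) = c {x, z} * \<bar>?h z\<bar>" if "z \<in> neighbours E x" for z
      using that conductance_pos[of "{x, z}"] by (simp add: neighbours_def abs_mult)
    ultimately have "(\<lambda>z. c {x, z} * \<bar>?h z\<bar>) summable_on neighbours E x"
      by (rule summable_on_cong[THEN iffD1, rotated])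
    with infsumI[OF sum] show ?thesis unfolding discrete_harmonic_at_def by blast
  qed
  moreover have "green P X A x y < \<infinity>" for x y
    using assms(7,8) by (rule green_finite)
  moreover have "((\<lambda>x. c {y, x} * (enn2real (green P X A x y) - enn2real (green P X A y y)))
      has_sum - total_conductance E c y) (neighbours E y)" if "y \<notin> A" for y
    using laplacian[OF that, of y] by simp
  ultimately show ?thesis by (intro conjI allI impI)
qed

end
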